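(* Let $T,N\in\mathcal{B}^{0,1}(V_n)$ be such that $T$ and $N$ commute ($TN=NT$), let $\varepsilon>0$, and suppose that $\sigma_S(N)$ is contained in the open ball $B_\varepsilon(0)$. If $s\in\mathbb{R}^{n+1}$ satisfies $\operatorname{dist}(s,\sigma_S(T))>\varepsilon$, then $s\in\rho_S(T+N)$ and $$\left((T+N)^2-2s_0(T+N)+|s|^2\mathcal{I}\right)^{-1}=\sum_{m=0}^\infty\left(\sum_{k=0}^m S_L^{-(k+1)}(s,T)\star_\ell S_L^{-(m-k+1)}(\overline{s},T)\right)N^m,$$ where the series converges in the operator norm.
   Context: Setting: $n\ge 1$; $\mathbb{R}_n$ is the real Clifford algebra with generators $e_1,\dots,e_n$, $e_ie_j+e_je_i=-2\delta_{ij}$, and basis $e_A$, $A\subset\{1,\dots,n\}$. A point of $\mathbb{R}^{n+1}$ is identified with the paravector $s=s_0+\sum_{j=1}^n s_je_j\in\mathbb{R}_n$; $\overline{s}=s_0-\sum_j s_je_j$, $|s|$ is the Euclidean norm, $B_r(0)$ is the open Euclidean ball of radius $r$ about $0$ in $\mathbb{R}^{n+1}$, and $\operatorname{dist}(s,A)=\inf_{x\in A}|s-x|$. $V$ is a real Banach space, $V_n=V\otimes\mathbb{R}_n$ with elements $v=\sum_A v_Ae_A$ and $\|v\|^2=\sum_A\|v_A\|^2$; it is a two-sided $\mathbb{R}_n$-module. For bounded linear $T_A:V\to V$, the operator $\sum_A T_Ae_A$ acts by $v\mapsto\sum_{A,B}T_A(v_B)e_Ae_B$; a scalar $a\in\mathbb{R}_n$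 is regarded as the operator $v\mapsto av$, so $aT$ and $Ta$ are compositions. $\mathcal{B}^{0,1}(V_n)$ is the set of operators $T=T_0+\sum_{j=1}^n e_jT_j$ with $T_0,\dots,T_n$ bounded linear operators on $V$ (not assumed to commute with each other). $\mathcal{I}$ is the identity; invertible means invertible as a bounded operator on $V_n$. $\sigma_S(T)=\{s\in\mathbb{R}^{n+1}: T^2-2s_0T+|s|^2\mathcal{I}\text{ is not invertible}\}$ is the $S$-spectrum, $\rho_S(T)=\mathbb{R}^{n+1}\setminus\sigma_S(T)$. For polynomials in $T$ with right coefficients, $\left(\sum_k T^ka_k\right)\star_\ell\left(\sum_k T^kb_k\right):=\sum_m T^m\sum_{k=0}^m a_kb_{m-k}$ ($a_k,b_k\in\mathbb{R}_n$), and $(\cdot)^{\star_\ell m}$ is the $m$-th power for this product, e.g. $(\overline{s}\,\mathcal{I}-T)^{\star_\ell m}=\sum_{k=0}^m\binom{m}{k}(-T)^k\overline{s}^{\,m-k}$. For $s\in\rho_S(T)$ and integers $p,q\ge0$ the following is a definition (the left-hand side is a formal notation): $$S_L^{-p}(s,T)\star_\ell S_L^{-q}(\overline{s},T):=(T^2-2s_0T+|s|^2\mathcal{I})^{-(p+q)}\left[(\overline{s}\,\mathcal{I}-T)^{\star_\ell p}\star_\ell(s\,\mathcal{I}-T)^{\star_\ell q}\right].$$ *)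

theory Defs
  imports "HOL-Analysis.Analysis" "HOL-Library.Poly_Mapping"
begin

section \<open>The real Clifford algebra\<close>

text \<open>
  The index set of the generators is an arbitrary nonempty finite linearly ordered type
  \<open>'n\<close> (so \<open>n = CARD('n) \<ge> 1\<close>). An element is its family of coefficients with respect to the
  basis \<open>e\<^sub>A\<close>, where \<open>A\<close> is a set of indices and \<open>e\<^sub>A\<close> is the product of the generators
  \<open>e\<^sub>i\<close>, \<open>i \<in> A\<close>, in increasing order.
\<close>

typedef ('n::finite) clifford = "UNIV :: ('n set \<Rightarrow> real) set"
  morphisms coeff Clifford ..

setup_lifting type_definition_clifford

lemma clifford_eqI: "(\<And>A. coeff a A = coeff b A) \<Longrightarrow> a = b"
  by transfer auto

text \<open>
  \<open>e\<^sub>A e\<^sub>B = csign A B \<cdot> e\<^sub>C\<close> with \<open>C\<close> the symmetric difference: each pair \<open>j < i\<close> with \<open>i \<in> A\<close>,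
  \<open>j \<in> B\<close> contributes one anticommutation, and each \<open>i \<in> A \<inter> B\<close> one factor \<open>e\<^sub>i\<^sup>2 = -1\<close>.
\<close>

definition csign :: "('n::{finite,linorder}) set \<Rightarrow> 'n set \<Rightarrow> real" where
  "csign A B = (- 1) ^ card {(i, j). i \<in> A \<and> j \<in> B \<and> j \<le> i}"

lemma csign_prod:
  "csign A B = (\<Prod>(i, j)\<in>UNIV. if i \<in> A \<and> j \<in> B \<and> j \<le> i then - 1 else 1)"
proof -
  have "(\<Prod>(i, j)\<in>UNIV. if i \<in> A \<and> j \<in> B \<and> j \<le> i then - 1 else (1::real))
     = (\<Prod>x\<in>UNIV. if x \<in> {(i, j). i \<in> A \<and> j \<in> B \<and> j \<le> i} then - 1 else 1)"
    by (rule prod.cong) (auto split: prod.splits)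
  also have "\<dots> = csign A B"
    by (simp add: prod.If_cases csign_def)
  finally show ?thesis ..
qed

lemma csign_sym_diff_left: "csign (sym_diff A B) C = csign A C * csign B C"
  unfolding csign_prod prod.distrib[symmetric] by (rule prod.cong) auto

lemma csign_sym_diff_right: "csign A (sym_diff B C) = csign A B * csign A C"
  unfolding csign_prod prod.distrib[symmetric] by (rule prod.cong) auto

lemma csign_empty [simp]: "csign {} A = 1" "csign A {} = 1"
  by (simp_all add: csign_def)

lemma csign_square [simp]: "csign A B * csign A B = 1"
  by (simp add: csign_def power_mult_distrib[symmetric])

lemma sum_sym_diff:
  fixes f :: "('n::finite) set \<Rightarrow> 'n set \<Rightarrow> 'b::comm_monoid_add"
  shows "(\<Sum>(A, B) | sym_diff A B = C. f A B) = (\<Sum>A\<in>UNIV. f A (sym_diff A C))"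
  by (rule sum.reindex_bij_witness[of _ "\<lambda>A. (A, sym_diff A C)" fst])
    (auto intro!: arg_cong[where f = "f _"])

instantiation clifford :: (finite) real_vector
begin

lift_definition zero_clifford :: "'a clifford" is "\<lambda>_. 0" .
lift_definition plus_clifford :: "'a clifford \<Rightarrow> 'a clifford \<Rightarrow> 'a clifford" is "\<lambda>a b A. a A + b A" .
lift_definition minus_clifford :: "'a clifford \<Rightarrow> 'a clifford \<Rightarrow> 'a clifford" is "\<lambda>a b A. a A - b A" .
lift_definition uminus_clifford :: "'a clifford \<Rightarrow> 'a clifford" is "\<lambda>a A. - a A" .
lift_definition scaleR_clifford :: "real \<Rightarrow> 'a clifford \<Rightarrow> 'a clifford" is "\<lambda>r a A. r * a A" .

instance
  by standard (transfer; simp add: algebra_simps)+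

end

instantiation clifford :: ("{finite, linorder}") real_algebra_1
begin

lift_definition one_clifford :: "'a clifford" is "\<lambda>A. if A = {} then 1 else 0" .

lift_definition times_clifford :: "'a clifford \<Rightarrow> 'a clifford \<Rightarrow> 'a clifford" is
  "\<lambda>a b C. \<Sum>(A, B) | sym_diff A B = C. csign A B * a A * b B" .

lemma coeff_times_clifford:
  "coeff (a * b) C = (\<Sum>A\<in>UNIV. csign A (sym_diff A C) * coeff a A * coeff b (sym_diff A C))"
  for a b :: "'a clifford"
  by transfer (rule sum_sym_diff)

lemma clifford_times_assoc: "(a * b) * c = a * (b * c)" for a b c :: "'a clifford"
proof (rule clifford_eqI)
  fix D :: "'a set"
  have "coeff ((a * b) * c) D =
    (\<Sum>P\<in>UNIV. \<Sum>A\<in>UNIV. csign P (sym_diff P D) * csign A (sym_diff A P) *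
        (coeff a A * coeff b (sym_diff A P) * coeff c (sym_diff P D)))"
    by (simp add: coeff_times_clifford sum_distrib_left sum_distrib_right mult_ac)
  also have "\<dots> = (\<Sum>A\<in>UNIV. \<Sum>P\<in>UNIV. csign P (sym_diff P D) * csign A (sym_diff A P) *
        (coeff a A * coeff b (sym_diff A P) * coeff c (sym_diff P D)))"
    by (rule sum.swap)
  also have "\<dots> = (\<Sum>A\<in>UNIV. \<Sum>Q\<in>UNIV. csign A (sym_diff A D) * csign Q (sym_diff Q (sym_diff A D)) *
        (coeff a A * coeff b Q * coeff c (sym_diff Q (sym_diff A D))))"
  proof (rule sum.cong[OF refl])
    fix A :: "'a set"
    show "(\<Sum>P\<in>UNIV. csign P (sym_diff P D) * csign A (sym_diff A P) *
        (coeff a A * coeff b (sym_diff A P) * coeff c (sym_diff P D)))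
      = (\<Sum>Q\<in>UNIV. csign A (sym_diff A D) * csign Q (sym_diff Q (sym_diff A D)) *
        (coeff a A * coeff b Q * coeff c (sym_diff Q (sym_diff A D))))"
    proof (rule sum.reindex_bij_witness[of _ "\<lambda>Q. sym_diff A Q" "\<lambda>P. sym_diff A P"])
      fix P :: "'a set"
      define Q where "Q = sym_diff A P"
      define R where "R = sym_diff P D"
      have P: "P = sym_diff A Q" and D: "sym_diff A D = sym_diff Q R"
        and R: "sym_diff Q (sym_diff A D) = R"
        unfolding Q_def R_def by auto
      have "csign A (sym_diff A D) * csign Q (sym_diff Q (sym_diff A D)) =
          csign P (sym_diff P D) * csign A (sym_diff A P)"
        unfolding R D unfolding R_def[symmetric] Q_def[symmetric]
        unfolding P csign_sym_diff_left csign_sym_diff_right by (simp add: csign_square[of Q Q, simplified] mult_ac)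
      then show "csign A (sym_diff A D) * csign (sym_diff A P) (sym_diff (sym_diff A P) (sym_diff A D)) *
          (coeff a A * coeff b (sym_diff A P) * coeff c (sym_diff (sym_diff A P) (sym_diff A D))) =
          csign P (sym_diff P D) * csign A (sym_diff A P) *
          (coeff a A * coeff b (sym_diff A P) * coeff c (sym_diff P D))"
        using R by (simp only: Q_def R_def)
    qed auto
  qed
  also have "\<dots> = coeff (a * (b * c)) D"
    by (simp add: coeff_times_clifford sum_distrib_left sum_distrib_right mult_ac)
  finally show "coeff ((a * b) * c) D = coeff (a * (b * c)) D" .
qed

instance
proof
  fix a b c :: "'a clifford" and r :: real
  show "(a * b) * c = a * (b * c)" by (rule clifford_times_assoc)
  show "(a + b) * c = a * c + b * c"
    by (rule clifford_eqI)
      (simp add: coeff_times_clifford plus_clifford.rep_eq sum.distrib[symmetric] algebra_simps)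
  show "a * (b + c) = a * b + a * c"
    by (rule clifford_eqI)
      (simp add: coeff_times_clifford plus_clifford.rep_eq sum.distrib[symmetric] algebra_simps)
  show "(r *\<^sub>R a) * b = r *\<^sub>R (a * b)"
    by (rule clifford_eqI)
      (simp add: coeff_times_clifford scaleR_clifford.rep_eq sum_distrib_left algebra_simps)
  show "a * (r *\<^sub>R b) = r *\<^sub>R (a * b)"
    by (rule clifford_eqI)
      (simp add: coeff_times_clifford scaleR_clifford.rep_eq sum_distrib_left algebra_simps)
  show "1 * a = a"
  proof (rule clifford_eqI)
    fix C :: "'a set"
    have "coeff (1 * a) C = (\<Sum>A::'a set\<in>UNIV. if A = {} then coeff a C else 0)"
      unfolding coeff_times_clifford one_clifford.rep_eq by (rule sum.cong) auto
    then show "coeff (1 * a) C = coeff a C" by simp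
  qed
  show "a * 1 = a"
  proof (rule clifford_eqI)
    fix C :: "'a set"
    have "coeff (a * 1) C = (\<Sum>A\<in>UNIV. if A = C then coeff a C else 0)"
      unfolding coeff_times_clifford one_clifford.rep_eq by (rule sum.cong) auto
    then show "coeff (a * 1) C = coeff a C" by simp
  qed
  show "(0::'a clifford) \<noteq> 1"
    by transfer (metis zero_neq_one)
qed

end

lift_definition cbasis :: "('n::finite) set \<Rightarrow> 'n clifford" is
  "\<lambda>A B. if B = A then 1 else 0" .

abbreviation cgen :: "'n::finite \<Rightarrow> 'n clifford" where
  "cgen j \<equiv> cbasis {j}"

lemma cbasis_times: "cbasis A * cbasis B = csign A B *\<^sub>R cbasis (sym_diff A B)"
proof (rule clifford_eqI)
  fix C :: "'a set"
  have "coeff (cbasis A * cbasis B) C =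
      (\<Sum>X\<in>UNIV. if X = A then (if C = sym_diff A B then csign A B else 0) else 0)"
    unfolding coeff_times_clifford cbasis.rep_eq by (rule sum.cong) auto
  then show "coeff (cbasis A * cbasis B) C = coeff (csign A B *\<^sub>R cbasis (sym_diff A B)) C"
    by (simp add: scaleR_clifford.rep_eq cbasis.rep_eq)
qed

lemma cbasis_empty: "cbasis {} = 1"
  by transfer auto

lemma csign_sing: "csign {i} {j} = (if j \<le> i then - 1 else 1)"
proof -
  have "{(a, b). a \<in> {i} \<and> b \<in> {j} \<and> b \<le> a} = (if j \<le> i then {(i, j)} else {})"
    by auto
  then show ?thesis by (simp add: csign_def)
qed

lemma cgen_anticommute:
  "cgen i * cgen j + cgen j * cgen i = (if i = j then - 2 else 0)"
proof (cases "i = j")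
  case True
  then show ?thesis
    by (simp add: cbasis_times csign_sing cbasis_empty)
next
  case False
  then have "sym_diff {i} {j} = sym_diff {j} {i}" "csign {i} {j} = - csign {j} {i}"
    by (auto simp: csign_sing)
  with False show ?thesis by (simp only: cbasis_times) simp
qed

lemma cbasis_insert:
  assumes "\<forall>a\<in>A. i < a"
  shows "cbasis (insert i A) = cgen i * cbasis A"
proof -
  have *: "{(a, b). a \<in> {i} \<and> b \<in> A \<and> b \<le> a} = {}" "sym_diff {i} A = insert i A"
    using assms by auto
  show ?thesis
    unfolding cbasis_times *(2) using *(1) by (simp only: csign_def) simp
qed


section \<open>Paravectors\<close>

text \<open>
  A point of Euclidean space of dimension \<open>n + 1\<close> is a pair \<open>(s\<^sub>0, (s\<^sub>j)\<^sub>j)\<close>; the library norm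
  of this product type is the Euclidean one.
\<close>

definition paravector :: "real \<times> (real ^ 'n::{finite,linorder}) \<Rightarrow> 'n clifford" where
  "paravector s = fst s *\<^sub>R 1 + (\<Sum>j\<in>UNIV. (snd s $ j) *\<^sub>R cgen j)"

definition conj_point :: "real \<times> (real ^ 'n) \<Rightarrow> real \<times> (real ^ 'n)" where
  "conj_point s = (fst s, - snd s)"

text \<open>
  The distance to a set takes values in the extended reals, so that the distance to the empty
  set is \<open>\<infinity>\<close> (whereas \<^const>\<open>infdist\<close> and \<^const>\<open>setdist\<close> give 0).
\<close>

definition edist_set :: "'a::metric_space \<Rightarrow> 'a set \<Rightarrow> ereal" where
  "edist_set s A = (INF x\<in>A. ereal (dist s x))"


section \<open>Operators on \<open>V\<^sub>n\<close>\<close>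

text \<open>
  \<open>V\<^sub>n = V \<otimes> \<real>\<^sub>n\<close> is the type \<open>'v ^ 'n set\<close>: the component at \<open>A\<close> is the coefficient of \<open>e\<^sub>A\<close>, and
  the library norm is the square root of the sum of the squared norms of the components.
\<close>

lemma bounded_linear_vec_lambdaI:
  fixes f :: "'i::finite \<Rightarrow> 'a::real_normed_vector \<Rightarrow> 'b::real_normed_vector"
  assumes "\<And>i. bounded_linear (f i)"
  shows "bounded_linear (\<lambda>v. \<chi> i. f i v)"
proof (rule bounded_linear_intro)
  interpret bounded_linear "f i" for i by (rule assms)
  show "(\<chi> i. f i (x + y)) = (\<chi> i. f i x) + (\<chi> i. f i y)" for x y
    by (simp add: vec_eq_iff add)
  show "(\<chi> i. f i (r *\<^sub>R x)) = r *\<^sub>R (\<chi> i. f i x)" for r x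
    by (simp add: vec_eq_iff scaleR)
  show "norm (\<chi> i. f i x) \<le> norm x * (\<Sum>i\<in>UNIV. onorm (f i))" for x
  proof -
    have "norm (\<chi> i. f i x) \<le> (\<Sum>i\<in>UNIV. norm (f i x))"
      unfolding norm_vec_def by (rule order_trans[OF L2_set_le_sum]) auto
    also have "\<dots> \<le> (\<Sum>i\<in>UNIV. onorm (f i) * norm x)"
      by (intro sum_mono onorm assms)
    finally show ?thesis by (simp only: sum_distrib_left mult.commute)
  qed
qed

text \<open>The operator \<open>v \<mapsto> a v\<close> for a Clifford number \<open>a\<close>.\<close>

lift_definition lmult :: "('n::{finite,linorder}) clifford \<Rightarrow>
    ('v::real_normed_vector ^ 'n set) \<Rightarrow>\<^sub>L ('v ^ 'n set)" is
  "\<lambda>a v. \<chi> C. \<Sum>(A, B) | sym_diff A B = C. (csign A B * coeff a A) *\<^sub>R (v $ B)"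
  unfolding sum_sym_diff
  by (intro bounded_linear_vec_lambdaI bounded_linear_sum bounded_linear_scaleR_right
      bounded_linear_compose[OF bounded_linear_scaleR_right bounded_linear_vec_nth])

text \<open>The componentwise extension \<open>\<Sum>\<^sub>B v\<^sub>B e\<^sub>B \<mapsto> \<Sum>\<^sub>B S(v\<^sub>B) e\<^sub>B\<close> of an operator \<open>S\<close> on \<open>V\<close>.\<close>

lift_definition extend_op :: "('v::real_normed_vector \<Rightarrow>\<^sub>L 'v) \<Rightarrow>
    ('v ^ 'n::finite set) \<Rightarrow>\<^sub>L ('v ^ 'n set)" is
  "\<lambda>S v. \<chi> B. S (v $ B)"
  by (intro bounded_linear_vec_lambdaI bounded_linear_compose[OF _ bounded_linear_vec_nth])

text \<open>\<open>\<B>\<^sup>0\<^sup>,\<^sup>1(V\<^sub>n)\<close>.\<close>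

definition paravector_operators ::
  "(('v::real_normed_vector ^ 'n::{finite,linorder} set) \<Rightarrow>\<^sub>L ('v ^ 'n set)) set" where
  "paravector_operators =
    {extend_op T0 + (\<Sum>j\<in>UNIV. lmult (cgen j) o\<^sub>L extend_op (T j)) | T0 T. True}"

definition op_power :: "('a::real_normed_vector \<Rightarrow>\<^sub>L 'a) \<Rightarrow> nat \<Rightarrow> 'a \<Rightarrow>\<^sub>L 'a" where
  "op_power T k = ((o\<^sub>L) T ^^ k) id_blinfun"

definition is_op_inverse :: "('a::real_normed_vector \<Rightarrow>\<^sub>L 'a) \<Rightarrow> ('a \<Rightarrow>\<^sub>L 'a) \<Rightarrow> bool" where
  "is_op_inverse Q R \<longleftrightarrow> R o\<^sub>L Q = id_blinfun \<and> Q o\<^sub>L R = id_blinfun"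

definition op_invertible :: "('a::real_normed_vector \<Rightarrow>\<^sub>L 'a) \<Rightarrow> bool" where
  "op_invertible Q \<longleftrightarrow> (\<exists>R. is_op_inverse Q R)"

definition op_inverse :: "('a::real_normed_vector \<Rightarrow>\<^sub>L 'a) \<Rightarrow> 'a \<Rightarrow>\<^sub>L 'a" where
  "op_inverse Q = (THE R. is_op_inverse Q R)"

lemma is_op_inverse_unique:
  assumes "is_op_inverse Q R" "is_op_inverse Q R'"
  shows "R = R'"
proof -
  have "R o\<^sub>L (Q o\<^sub>L R') = (R o\<^sub>L Q) o\<^sub>L R'"
    by (rule blinfun_eqI) simp
  moreover have "R o\<^sub>L id_blinfun = R" "id_blinfun o\<^sub>L R' = R'"
    by (rule blinfun_eqI, simp)+
  ultimately show ?thesis using assms by (simp add: is_op_inverse_def)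
qed

lemma op_inverse: "op_invertible Q \<Longrightarrow> is_op_inverse Q (op_inverse Q)"
  unfolding op_invertible_def op_inverse_def by (metis is_op_inverse_unique theI)


section \<open>The \<open>S\<close>-spectrum\<close>

definition S_pencil :: "real \<times> (real ^ 'n::finite) \<Rightarrow>
    (('v::real_normed_vector ^ 'n set) \<Rightarrow>\<^sub>L ('v ^ 'n set)) \<Rightarrow>
    ('v ^ 'n set) \<Rightarrow>\<^sub>L ('v ^ 'n set)" where
  "S_pencil s T = op_power T 2 - (2 * fst s) *\<^sub>R T + (norm s)\<^sup>2 *\<^sub>R id_blinfun"

definition S_spectrum :: "(('v::real_normed_vector ^ 'n::finite set) \<Rightarrow>\<^sub>L ('v ^ 'n set)) \<Rightarrow>
    (real \<times> (real ^ 'n)) set" where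
  "S_spectrum T = {s. \<not> op_invertible (S_pencil s T)}"

definition S_resolvent_set :: "(('v::real_normed_vector ^ 'n::finite set) \<Rightarrow>\<^sub>L ('v ^ 'n set)) \<Rightarrow>
    (real \<times> (real ^ 'n)) set" where
  "S_resolvent_set T = UNIV - S_spectrum T"


section \<open>Polynomials with right coefficients\<close>

text \<open>
  A polynomial \<open>\<Sum>\<^sub>k T\<^sup>k a\<^sub>k\<close> with right coefficients is represented by its finitely supported
  coefficient sequence \<open>(a\<^sub>k)\<^sub>k\<close>. The ring product of this type is the convolution product
  \<open>\<star>\<^sub>\<ell>\<close> (note that \<open>'a poly\<close> has a product only for commutative coefficients).
\<close>

type_synonym 'n cpoly = "nat \<Rightarrow>\<^sub>0 'n clifford"

lemma lookup_cpoly_times: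
  fixes P Q :: "('n::{finite,linorder}) cpoly"
  shows "Poly_Mapping.lookup (P * Q) m =
    (\<Sum>k\<le>m. Poly_Mapping.lookup P k * Poly_Mapping.lookup Q (m - k))"
proof -
  have inner: "(\<Sum>q. Poly_Mapping.lookup Q q when m = k + q) =
      (if k \<le> m then Poly_Mapping.lookup Q (m - k) else 0)" for k
  proof -
    have "(\<lambda>q. Poly_Mapping.lookup Q q when m = k + q) =
        (\<lambda>q. (if k \<le> m then Poly_Mapping.lookup Q (m - k) else 0) when q = m - k)"
      by (auto simp: when_def)
    then show ?thesis by (simp only: Sum_any_when_equal)
  qed
  have "Poly_Mapping.lookup (P * Q) m = (\<Sum>k. Poly_Mapping.lookup P k *
      (if k \<le> m then Poly_Mapping.lookup Q (m - k) else 0))"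
    by (simp add: times_poly_mapping.rep_eq prod_fun_def inner)
  also have "\<dots> = (\<Sum>k\<le>m. Poly_Mapping.lookup P k *
      (if k \<le> m then Poly_Mapping.lookup Q (m - k) else 0))"
    by (rule Sum_any.expand_superset) (auto split: if_splits intro: ccontr)
  finally show ?thesis by simp
qed

definition cpoly_eval :: "(('v::real_normed_vector ^ 'n::{finite,linorder} set) \<Rightarrow>\<^sub>L ('v ^ 'n set)) \<Rightarrow>
    'n cpoly \<Rightarrow> ('v ^ 'n set) \<Rightarrow>\<^sub>L ('v ^ 'n set)" where
  "cpoly_eval T P =
    (\<Sum>k\<in>Poly_Mapping.keys P. op_power T k o\<^sub>L lmult (Poly_Mapping.lookup P k))"

text \<open>The polynomial \<open>s \<I> - T\<close>.\<close>

definition linear_cpoly :: "real \<times> (real ^ 'n::{finite,linorder}) \<Rightarrow> 'n cpoly" where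
  "linear_cpoly s = Poly_Mapping.single 0 (paravector s) - Poly_Mapping.single 1 1"

text \<open>
  The expression written \<open>S\<^sub>L\<^sup>-\<^sup>p(s,T) \<star>\<^sub>\<ell> S\<^sub>L\<^sup>-\<^sup>q(s',T)\<close>, where \<open>s'\<close> is the conjugate of \<open>s\<close>; it is a formal
  notation for the right-hand side below. It is meaningful for \<open>s\<close> outside the \<open>S\<close>-spectrum of \<open>T\<close>.
\<close>

definition SL_star :: "real \<times> (real ^ 'n::{finite,linorder}) \<Rightarrow>
    (('v::real_normed_vector ^ 'n set) \<Rightarrow>\<^sub>L ('v ^ 'n set)) \<Rightarrow>
    nat \<Rightarrow> nat \<Rightarrow> ('v ^ 'n set) \<Rightarrow>\<^sub>L ('v ^ 'n set)" where
  "SL_star s T p q = op_power (op_inverse (S_pencil s T)) (p + q) o\<^sub>L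
    cpoly_eval T (linear_cpoly (conj_point s) ^ p * linear_cpoly s ^ q)"

end

(*
  Embed the bounded operators on V_n into a complex Banach algebra and put z = s_0 + i |s - s_0|.
  Then T^2 - 2 s_0 T + |s|^2 = (z - T)(z* - T), and by axial symmetry of the S-spectrum the
  hypotheses say that the complex spectrum of N lies in the disc of radius epsilon while z and z*
  have distance > epsilon from that of T. So by the spectral radius formula X = (z - T)^{-1} and
  Y = (z* - T)^{-1} give geometric series sum (XN)^m and sum (YN)^m that converge absolutely, and
  their Cauchy product, multiplied by XY, is ((z - T - N)(z* - T - N))^{-1}.
  For the m-th term, sum_{k<=m} (s* - x)^k (s - x)^{m-k} satisfies a recursion whose coefficients
  s + s* - 2x and (s* - x)(s - x) are real polynomials in x. Hence evaluating it at T does not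
  see the Clifford units and agrees with sum_k (z* - T)^k (z - T)^{m-k}.
*)
theory Submission
  imports Defs
begin

section \<open>Powers and the spectrum in a complex Banach algebra\<close>

text \<open>The imaginary unit is adjoined from outside because the one that \<open>s\<close>
  singles out inside the Clifford algebra, the direction of its vector part, need not commute with
  \<open>T\<close>. For the same reason \<open>cpoly_eval T\<close> is not multiplicative: the
  factors \<open>linear_cpoly s\<close> and \<open>linear_cpoly (conj_point s)\<close> cannot be
  evaluated one by one, and the two versions of the m-th term are compared only as solutions of one
  recursion. Spectra, not norms, are given, so neither \<open>X\<close> nor \<open>N\<close> has a
  useful norm bound of its own; only their high powers do. Since \<open>X\<close> and
  \<open>N\<close> commute, \<open>(X * N) ^ n\<close> splits and the growth rates of the two powers
  can be estimated separately. The strict gap between \<epsilon> and the distance supplies the ratio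
  below 1.\<close>

lemma commuting_power_mult_distrib:
  fixes a b :: "'a::monoid_mult"
  assumes "a * b = b * a"
  shows "(a * b) ^ n = a ^ n * b ^ n"
proof (induction n)
  case (Suc n)
  have "b * a ^ n = a ^ n * b"
    by (rule power_commuting_commutes[symmetric]) (rule assms)
  then have "a * (b * (a ^ n * b ^ n)) = a * (a ^ n * (b * b ^ n))"
    by (simp add: mult.assoc[symmetric])
  with Suc show ?case by (simp add: mult.assoc)
qed simp

lemma one_diff_power_factor:
  fixes x :: "'a::ring_1"
  shows "(1 - x) * (\<Sum>k<n. x ^ k) = 1 - x ^ n"
  by (induction n) (simp_all add: distrib_left left_diff_distrib)

lemma cis_root_power:
  assumes "n > 0"
  shows "cis (2 * pi * real k / real n) ^ n = 1"
proof -
  have "cis (2 * pi * real k / real n) ^ n = cis (2 * pi * real k)"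
    unfolding Complex.DeMoivre using assms by (intro arg_cong[where f = cis]) simp
  then show ?thesis by (simp add: cis_multiple_2pi)
qed

lemma sum_cis_roots:
  assumes "0 < k" "k < n"
  shows "(\<Sum>j<n. cis (2 * pi * real j / real n) ^ k) = 0"
proof -
  \<comment> \<open>Exchanging the roles of \<open>j\<close> and \<open>k\<close> makes the sum
    geometric in \<open>j\<close>.\<close>
  define w where "w = cis (2 * pi * real k / real n)"
  have wn: "w ^ n = 1"
    using assms unfolding w_def by (intro cis_root_power) simp
  have w1: "w \<noteq> 1"
  proof
    assume "w = 1"
    then have "cos (2 * pi * real k / real n) = 1" by (simp add: w_def complex_eq_iff)
    then obtain m :: int where m: "2 * pi * real k / real n = m * 2 * pi"
      unfolding cos_one_2pi_int by auto
    then have "real k = m * real n" using assms by (simp add: field_simps)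
    then have "int k = m * int n" by (metis of_int_eq_iff of_int_mult of_int_of_nat_eq)
    then have "int n dvd int k" by simp
    then show False using assms by (simp add: nat_dvd_not_less)
  qed
  have "(\<Sum>j<n. cis (2 * pi * real j / real n) ^ k) = (\<Sum>j<n. w ^ j)"
    unfolding w_def Complex.DeMoivre by (intro sum.cong refl arg_cong[where f = cis]) simp
  also have "\<dots> = 0"
    using w1 wn by (simp add: geometric_sum)
  finally show ?thesis .
qed

text \<open>\<open>c\<close> need not map into the centre. Commutation with \<open>c\<close> is
  assumed for each element concerned, because among the real endomorphisms of a complex space only
  the complex linear ones satisfy it.\<close>

locale complex_scalars =
  fixes c :: "complex \<Rightarrow> 'a::{real_normed_algebra_1, banach}"
  assumes bounded_linear_c: "bounded_linear c"
    and c_mult: "c (x * y) = c x * c y"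
    and c_one [simp]: "c 1 = 1"
begin

interpretation c: bounded_linear c by (rule bounded_linear_c)

lemma c_power: "c (x ^ k) = c x ^ k"
  by (induction k) (simp_all add: c_mult)

lemma c_of_real: "c (complex_of_real r) = of_real r"
  using c.scaleR[of r 1] by (simp add: scaleR_conv_of_real)

text \<open>If \<open>l\<close> is \<open>t\<close> times an \<open>n\<close>-th root of unity,
  \<open>1 - c l * X\<close> divides \<open>1 - (t *\<^sub>R X) ^ n\<close>, with quotient the sum
  of \<open>c (l ^ k) * X ^ k\<close> over \<open>k < n\<close>. Averaging over the roots kills
  every power except \<open>k = 0\<close>.\<close>

lemma resolvent_roots_average:
  assumes comm: "\<And>x. c x * X = X * c x" and "n > 0"
    and G: "\<And>j. j < n \<Longrightarrow> G (of_real t * cis (2 * pi * real j / real n)) *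
      (1 - c (of_real t * cis (2 * pi * real j / real n)) * X) = 1"
  shows "((\<Sum>j<n. G (of_real t * cis (2 * pi * real j / real n))) /\<^sub>R real n) * (1 - (t *\<^sub>R X) ^ n) = 1"
proof -
  define l where "l j = of_real t * cis (2 * pi * real j / real n)" for j
  have ln: "l j ^ n = of_real t ^ n" for j
    unfolding l_def power_mult_distrib cis_root_power[OF \<open>n > 0\<close>] by simp
  have pw: "(c x * X) ^ k = c (x ^ k) * X ^ k" for x k
    by (simp add: c_power commuting_power_mult_distrib[OF comm])
  have tX: "(t *\<^sub>R X) ^ k = c (of_real t ^ k) * X ^ k" for k
  proof -
    have "c (of_real t ^ k) = of_real (t ^ k)"
      by (metis c_of_real of_real_power)
    then show ?thesis by (simp only: scaleR_power) (simp add: scaleR_conv_of_real)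
  qed
  have G': "G (l j) * (1 - (t *\<^sub>R X) ^ n) = (\<Sum>k<n. c (l j ^ k) * X ^ k)" if "j < n" for j
  proof -
    have "1 - (t *\<^sub>R X) ^ n = 1 - (c (l j) * X) ^ n"
      unfolding pw tX ln ..
    also have "\<dots> = (1 - c (l j) * X) * (\<Sum>k<n. (c (l j) * X) ^ k)"
      by (rule one_diff_power_factor[symmetric])
    finally show ?thesis
      using G[OF that] by (simp add: mult.assoc[symmetric] pw flip: l_def)
  qed
  have "(\<Sum>j<n. G (l j)) * (1 - (t *\<^sub>R X) ^ n) = (\<Sum>j<n. \<Sum>k<n. c (l j ^ k) * X ^ k)"
    unfolding sum_distrib_right by (intro sum.cong refl G') simp
  also have "\<dots> = (\<Sum>k<n. c (\<Sum>j<n. l j ^ k) * X ^ k)"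
    by (subst sum.swap) (simp add: c.sum sum_distrib_right)
  also have "\<dots> = (\<Sum>k<n. if k = 0 then of_nat n else 0)"
  proof (rule sum.cong[OF refl])
    fix k assume "k \<in> {..<n}"
    then have "(\<Sum>j<n. l j ^ k) = (if k = 0 then of_nat n else 0)"
      using sum_cis_roots[of k n]
      by (auto simp: l_def power_mult_distrib sum_distrib_left[symmetric])
    then show "c (\<Sum>j<n. l j ^ k) * X ^ k = (if k = 0 then of_nat n else 0)"
      using c_of_real[of "real n"] by (simp add: c.zero)
  qed
  also have "\<dots> = of_nat n"
    using \<open>n > 0\<close> by simp
  also have "\<dots> = real n *\<^sub>R 1"
    by (simp add: scaleR_conv_of_real)
  finally show ?thesis
    using \<open>n > 0\<close> unfolding l_def mult_scaleR_left by simp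
qed

text \<open>By the resolvent identity \<open>G x - G y = G x * (c (x - y) * X) * G y\<close>, a
  bound on \<open>G\<close> gives the Lipschitz estimate. The bound comes from continuity on the
  compact disc, which the same identity yields locally.\<close>

lemma resolvent_bounded_lipschitz:
  assumes comm: "\<And>x. c x * X = X * c x"
    and G1: "\<And>x. cmod x \<le> R \<Longrightarrow> G x * (1 - c x * X) = 1"
    and G2: "\<And>x. cmod x \<le> R \<Longrightarrow> (1 - c x * X) * G x = 1"
  obtains M L where "M \<ge> 0" "L > 0" "\<And>x. cmod x \<le> R \<Longrightarrow> norm (G x) \<le> M"
    "\<And>x y. \<lbrakk>cmod x \<le> R; cmod y \<le> R\<rbrakk> \<Longrightarrow> norm (G x - G y) \<le> L * cmod (x - y)"
proof -
  obtain K where K: "K \<ge> 0" "\<And>x. norm (c x) \<le> cmod x * K"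
    using c.nonneg_bounded by blast
  have res: "G x - G y = G x * (c (x - y) * X) * G y" if "cmod x \<le> R" "cmod y \<le> R" for x y
  proof -
    have "G x * (c (x - y) * X) * G y = G x * ((1 - c y * X) - (1 - c x * X)) * G y"
      by (simp add: c.diff algebra_simps)
    also have "\<dots> = G x * ((1 - c y * X) * G y) - (G x * (1 - c x * X)) * G y"
      by (simp only: right_diff_distrib left_diff_distrib mult.assoc)
    finally show ?thesis using G1[OF that(1)] G2[OF that(2)] by simp
  qed
  have nres: "norm (G x - G y) \<le> norm (G x) * (cmod (x - y) * K * norm X) * norm (G y)"
    if "cmod x \<le> R" "cmod y \<le> R" for x y
  proof -
    have "norm (G x - G y) \<le> norm (G x) * norm (c (x - y) * X) * norm (G y)"
      unfolding res[OF that] by (meson norm_mult_ineq norm_ge_zero mult_right_mono order_trans)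
    also have "\<dots> \<le> norm (G x) * (cmod (x - y) * K * norm X) * norm (G y)"
      by (intro mult_right_mono mult_left_mono norm_ge_zero
          order_trans[OF norm_mult_ineq] K)
    finally show ?thesis .
  qed
  define B where "B = K * norm X + 1"
  have B: "B > 0" "K * norm X \<le> B" using K(1) by (simp_all add: B_def add_nonneg_pos)
  have nresB: "norm (G x - G y) \<le> norm (G x) * (cmod (x - y) * B) * norm (G y)"
    if "cmod x \<le> R" "cmod y \<le> R" for x y
  proof -
    have "norm (G x) * (cmod (x - y) * K * norm X) * norm (G y) \<le>
        norm (G x) * (cmod (x - y) * B) * norm (G y)"
      using B(2) by (intro mult_right_mono mult_left_mono) (auto simp: mult.assoc intro: mult_left_mono)
    then show ?thesis using nres[OF that] by linarith
  qed
  have cont: "continuous_on (cball 0 R) (\<lambda>x. norm (G x))"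
    unfolding continuous_on_def
  proof
    fix x :: complex assume "x \<in> cball 0 R"
    then have x: "cmod x \<le> R" by simp
    \<comment> \<open>This radius makes \<open>norm (G x) * (e * B)\<close> at most 1/2, so that the
      term with \<open>norm (G y)\<close> can be absorbed and
      \<open>norm (G y) \<le> 2 * norm (G x)\<close>.\<close>
    define e where "e = 1 / (2 * B * (norm (G x) + 1))"
    have e: "e > 0" using B by (simp add: e_def add_nonneg_pos)
    have bound: "norm (G x - G y) \<le> cmod (x - y) * (norm (G x) * B * (2 * norm (G x)))"
      if y: "cmod y \<le> R" "dist y x < e" for y
    proof -
      have "norm (G x) * (cmod (x - y) * B) \<le> norm (G x) * (e * B)"
        using y B by (intro mult_left_mono mult_right_mono) (auto simp: dist_norm norm_minus_commute)
      also have "\<dots> \<le> 1 / 2"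
      proof -
        have "e * B = 1 / (2 * (norm (G x) + 1))" using B by (simp add: e_def)
        moreover have "0 < 2 * (norm (G x) + 1)" by (simp add: add_nonneg_pos)
        ultimately show ?thesis by (simp add: divide_le_eq)
      qed
      finally have half: "norm (G x) * (cmod (x - y) * B) \<le> 1 / 2" .
      have "norm (G y) - norm (G x) \<le> norm (G x - G y)"
        by (metis norm_minus_commute norm_triangle_ineq2)
      also have "\<dots> \<le> norm (G x) * (cmod (x - y) * B) * norm (G y)"
        by (rule nresB[OF x y(1)])
      also have "\<dots> \<le> 1 / 2 * norm (G y)"
        by (rule mult_right_mono[OF half]) simp
      finally have "norm (G y) \<le> 2 * norm (G x)" by simp
      then have "norm (G x) * (cmod (x - y) * B) * norm (G y) \<le>
          norm (G x) * (cmod (x - y) * B) * (2 * norm (G x))"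
        using B by (intro mult_left_mono) auto
      then show ?thesis using nresB[OF x y(1)] by (simp add: mult_ac)
    qed
    have "((\<lambda>y. norm (G x - G y)) \<longlongrightarrow> 0) (at x within cball 0 R)"
    proof (rule Lim_null_comparison)
      show "\<forall>\<^sub>F y in at x within cball 0 R.
          norm (norm (G x - G y)) \<le> cmod (x - y) * (norm (G x) * B * (2 * norm (G x)))"
        unfolding eventually_at using e bound by (auto simp: intro!: exI[of _ e])
      show "((\<lambda>y. cmod (x - y) * (norm (G x) * B * (2 * norm (G x)))) \<longlongrightarrow> 0)
          (at x within cball 0 R)"
        using tendsto_diff[OF tendsto_const tendsto_ident_at, of x x "cball 0 R"]
        by (intro tendsto_mult_left_zero tendsto_norm_zero) simp
    qed
    then have "((\<lambda>y. norm (G y - G x)) \<longlongrightarrow> 0) (at x within cball 0 R)"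
      by (simp only: norm_minus_commute)
    then have "(G \<longlongrightarrow> G x) (at x within cball 0 R)"
      by (rule LIM_zero_cancel[OF tendsto_norm_zero_cancel])
    then show "((\<lambda>y. norm (G y)) \<longlongrightarrow> norm (G x)) (at x within cball 0 R)"
      by (rule tendsto_norm)
  qed
  have "bounded ((\<lambda>x. norm (G x)) ` cball 0 R)"
    by (intro compact_imp_bounded compact_continuous_image cont compact_cball)
  then obtain M where M: "M > 0" "\<And>x. cmod x \<le> R \<Longrightarrow> norm (G x) \<le> M"
    unfolding bounded_pos by auto
  show thesis
  proof (rule that)
    show "M \<ge> 0" "M * B * M > 0" using M(1) B(1) by simp_all
    show "norm (G x) \<le> M" if "cmod x \<le> R" for x by (rule M(2)[OF that])
    fix x y assume xy: "cmod x \<le> R" "cmod y \<le> R"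
    have "norm (G x) * (cmod (x - y) * B) * norm (G y) \<le> M * (cmod (x - y) * B) * M"
      using M B xy by (intro mult_mono) auto
    then show "norm (G x - G y) \<le> M * B * M * cmod (x - y)"
      using nresB[OF xy] by (simp add: mult_ac)
  qed
qed

text \<open>
  Half of the spectral radius formula, by Rickart's method: \<open>1 - (t X)\<^sup>n\<close> is inverted by the average
  of the resolvent over \<open>n\<close>-th roots of unity, and these averages are Lipschitz in \<open>t\<close> uniformly
  in \<open>n\<close>; so \<open>(t X)\<^sup>n \<longlonglongrightarrow> 0\<close> propagates from \<open>t = 0\<close> in steps of a fixed size.
\<close>

lemma power_tendsto_zero:
  assumes comm: "\<And>x. c x * X = X * c x"
    and inv: "\<And>x. cmod x \<le> R \<Longrightarrow> \<exists>Y. Y * (1 - c x * X) = 1 \<and> (1 - c x * X) * Y = 1"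
    and u: "0 \<le> u" "u < R"
  shows "(\<lambda>n. (u *\<^sub>R X) ^ n) \<longlonglongrightarrow> 0"
proof -
  obtain G where G1: "\<And>x. cmod x \<le> R \<Longrightarrow> G x * (1 - c x * X) = 1"
    and G2: "\<And>x. cmod x \<le> R \<Longrightarrow> (1 - c x * X) * G x = 1"
    using inv by metis
  obtain M L where M: "M \<ge> 0" "\<And>x. cmod x \<le> R \<Longrightarrow> norm (G x) \<le> M"
    and L: "L > 0" "\<And>x y. \<lbrakk>cmod x \<le> R; cmod y \<le> R\<rbrakk> \<Longrightarrow> norm (G x - G y) \<le> L * cmod (x - y)"
    using resolvent_bounded_lipschitz[OF comm G1 G2] by metis
  define A where
    "A n t = (\<Sum>j<n. G (of_real t * cis (2 * pi * real j / real n))) /\<^sub>R real n" for n and t :: real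
  have mod: "cmod (of_real t * cis \<phi>) \<le> R" if "0 \<le> t" "t \<le> R" for t \<phi>
    using that by (simp add: norm_mult)
  have A1: "A n t * (1 - (t *\<^sub>R X) ^ n) = 1" if "0 \<le> t" "t \<le> R" "n > 0" for n t
    unfolding A_def using that by (intro resolvent_roots_average comm G1 mod)
  have AM: "norm (A n t) \<le> M" if "0 \<le> t" "t \<le> R" for n t
  proof (cases "n = 0")
    case False
    have "norm (\<Sum>j<n. G (of_real t * cis (2 * pi * real j / real n))) \<le> (\<Sum>j<n. M)"
      by (intro sum_norm_le M mod that)
    with False show ?thesis by (simp add: A_def field_simps)
  qed (simp add: A_def M)
  have AL: "norm (A n t - A n t') \<le> L * \<bar>t - t'\<bar>"
    if "0 \<le> t" "t \<le> R" "0 \<le> t'" "t' \<le> R" for n t t'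
  proof (cases "n = 0")
    case False
    have "norm (\<Sum>j<n. G (of_real t * cis (2 * pi * real j / real n)) -
        G (of_real t' * cis (2 * pi * real j / real n))) \<le> (\<Sum>j<n. L * \<bar>t - t'\<bar>)"
    proof (rule sum_norm_le)
      fix j
      let ?z = "cis (2 * pi * real j / real n)"
      have "norm (G (of_real t * ?z) - G (of_real t' * ?z)) \<le> L * cmod (of_real t * ?z - of_real t' * ?z)"
        by (intro L mod that)
      also have "cmod (of_real t * ?z - of_real t' * ?z) = \<bar>t - t'\<bar>"
        by (simp add: norm_mult flip: left_diff_distrib of_real_diff)
      finally show "norm (G (of_real t * ?z) - G (of_real t' * ?z)) \<le> L * \<bar>t - t'\<bar>" .
    qed
    moreover have "A n t - A n t' = (\<Sum>j<n. G (of_real t * cis (2 * pi * real j / real n)) -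
        G (of_real t' * cis (2 * pi * real j / real n))) /\<^sub>R real n"
      by (simp add: A_def sum_subtractf scaleR_diff_right)
    ultimately show ?thesis using False by (simp add: field_simps)
  qed (simp add: A_def L less_imp_le)
  \<comment> \<open>A step of this length moves the averages by at most 1/4. Another 1/4 comes from
    \<open>A n t - 1 = A n t * (t *\<^sub>R X) ^ n\<close> for large \<open>n\<close>, and together
    they keep \<open>A n t'\<close> within 1/2 of 1.\<close>
  define \<delta> where "\<delta> = 1 / (4 * L)"
  have \<delta>: "\<delta> > 0" "L * \<delta> = 1 / 4" using L by (simp_all add: \<delta>_def)
  have step: "(\<lambda>n. (u *\<^sub>R X) ^ n) \<longlonglongrightarrow> 0"
    if t0: "(\<lambda>n. (t *\<^sub>R X) ^ n) \<longlonglongrightarrow> 0" and t: "0 \<le> t" "t \<le> t'" "t' \<le> t + \<delta>" "t' \<le> R"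
      and u: "0 \<le> u" "u < t'" for t t' u
  proof -
    have tR: "t \<le> R" "0 \<le> t'" using t by auto
    have "\<forall>\<^sub>F n in sequentially. norm ((t *\<^sub>R X) ^ n) < 1 / (4 * (M + 1))"
      using tendstoD[OF t0, of "1 / (4 * (M + 1))"] M by (simp add: dist_norm)
    then have "\<forall>\<^sub>F n in sequentially. norm ((t' *\<^sub>R X) ^ n) \<le> 1"
      using eventually_gt_at_top[of 0]
    proof eventually_elim
      case (elim n)
      have "A n t - 1 = A n t * (t *\<^sub>R X) ^ n"
        using A1[OF t(1) tR(1) elim(2)] by (simp add: right_diff_distrib algebra_simps)
      then have "norm (A n t - 1) \<le> norm (A n t) * norm ((t *\<^sub>R X) ^ n)"
        by (simp only: norm_mult_ineq)
      also have "\<dots> \<le> M * (1 / (4 * (M + 1)))"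
        using elim M AM[OF t(1) tR(1)] by (intro mult_mono) auto
      also have "\<dots> \<le> 1 / 4" using M by (simp add: field_simps)
      finally have 1: "norm (A n t - 1) \<le> 1 / 4" .
      have "norm (A n t' - A n t) \<le> L * \<bar>t' - t\<bar>"
        by (intro AL t tR)
      also have "\<dots> \<le> L * \<delta>" using t L by (intro mult_left_mono) auto
      finally have "norm (A n t' - A n t) \<le> 1 / 4" using \<delta> by simp
      with 1 have 2: "norm (1 - A n t') \<le> 1 / 2"
        using norm_triangle_ineq[of "A n t' - A n t" "A n t - 1"]
        by (simp add: norm_minus_commute)
      \<comment> \<open>Writing \<open>w\<close> for the left-hand side, this gives
        \<open>norm w \<le> (1 + norm w) / 2\<close>, hence \<open>norm w \<le> 1\<close>.\<close>
      have "(t' *\<^sub>R X) ^ n = (A n t' - 1) * (1 - (t' *\<^sub>R X) ^ n)"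
        using A1[OF tR(2) t(4) elim(2)] by (simp add: left_diff_distrib)
      then have "norm ((t' *\<^sub>R X) ^ n) \<le> norm (1 - A n t') * norm (1 - (t' *\<^sub>R X) ^ n)"
        by (metis norm_mult_ineq norm_minus_commute)
      also have "\<dots> \<le> 1 / 2 * (1 + norm ((t' *\<^sub>R X) ^ n))"
        using 2 norm_triangle_ineq4[of 1 "(t' *\<^sub>R X) ^ n"] by (intro mult_mono) auto
      finally show ?case by simp
    qed
    \<comment> \<open>Boundedness at \<open>t'\<close> turns into geometric decay at any smaller
      \<open>u\<close>.\<close>
    then have "\<forall>\<^sub>F n in sequentially. norm ((u *\<^sub>R X) ^ n) \<le> (u / t') ^ n"
    proof eventually_elim
      case (elim n)
      have "(u / t') ^ n * t' ^ n = u ^ n"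
        unfolding power_mult_distrib[symmetric] using u by simp
      then have "(u *\<^sub>R X) ^ n = (u / t') ^ n *\<^sub>R (t' *\<^sub>R X) ^ n"
        by simp
      then have "norm ((u *\<^sub>R X) ^ n) = (u / t') ^ n * norm ((t' *\<^sub>R X) ^ n)"
        using u by (simp only: norm_scaleR) simp
      also have "\<dots> \<le> (u / t') ^ n * 1"
        using elim u by (intro mult_left_mono) auto
      finally show ?case by simp
    qed
    moreover have "(\<lambda>n. (u / t') ^ n) \<longlonglongrightarrow> 0"
      using u by (intro LIMSEQ_power_zero) simp
    ultimately show ?thesis
      by (rule Lim_null_comparison)
  qed
  have reach: "(\<lambda>n. (u *\<^sub>R X) ^ n) \<longlonglongrightarrow> 0"
    if "0 \<le> u" "u < R" "u \<le> real k * (\<delta> / 2)" for u k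
    using that
  proof (induction k arbitrary: u)
    case 0
    then have "u = 0" by simp
    then show ?case
      by (intro tendsto_eventually eventually_mono[OF eventually_gt_at_top[of 0]])
        (simp add: zero_power)
  next
    case (Suc k)
    \<comment> \<open>Steps of half the length, since a step from \<open>?t\<close> reaches only
      radii strictly below \<open>?t + \<delta>\<close>.\<close>
    let ?t = "max 0 (u - \<delta> / 2)"
    show ?case
    proof (rule step[of ?t "min R (?t + \<delta>)"])
      show "(\<lambda>n. (?t *\<^sub>R X) ^ n) \<longlonglongrightarrow> 0"
        using Suc.prems \<delta>(1) by (intro Suc.IH) (auto simp: max_def algebra_simps)
    qed (use Suc.prems \<delta>(1) in auto)
  qed
  obtain k where "u < real k * (\<delta> / 2)"
    using ex_less_of_nat_mult[of "\<delta> / 2" u] \<delta>(1) half_gt_zero by blast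
  then show ?thesis
    by (intro reach[OF u] less_imp_le)
qed

end

section \<open>The perturbation series in a complex Banach algebra\<close>

definition is_inverse :: "'a::monoid_mult \<Rightarrow> 'a \<Rightarrow> bool" where
  "is_inverse x y \<longleftrightarrow> x * y = 1 \<and> y * x = 1"

lemma is_inverseI:
  fixes x :: "'a::monoid_mult"
  assumes "y * x = 1" "x * z = 1"
  shows "y = z" "is_inverse x y"
proof -
  have "y = y * (x * z)" using assms by simp
  also have "\<dots> = (y * x) * z" by (simp only: mult.assoc)
  also have "\<dots> = z" using assms by simp
  finally show "y = z" .
  then show "is_inverse x y" using assms by (simp add: is_inverse_def)
qed

lemma is_inverse_unique: "is_inverse x y \<Longrightarrow> is_inverse x z \<Longrightarrow> y = z"
  by (rule is_inverseI(1)) (auto simp: is_inverse_def)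

lemma is_inverse_mult: "is_inverse x x' \<Longrightarrow> is_inverse y y' \<Longrightarrow> is_inverse (x * y) (y' * x')"
proof (rule is_inverseI(2))
  assume "is_inverse x x'" "is_inverse y y'"
  then have 1: "x' * x = 1" "x * x' = 1" "y' * y = 1" "y * y' = 1"
    by (simp_all add: is_inverse_def)
  have "y' * x' * (x * y) = y' * (x' * x) * y" "x * y * (y' * x') = x * (y * y') * x'"
    by (simp_all only: mult.assoc)
  then show "y' * x' * (x * y) = 1" "x * y * (y' * x') = 1"
    by (simp_all add: 1)
qed

lemma is_inverse_sym: "is_inverse x y \<Longrightarrow> is_inverse y x"
  by (auto simp: is_inverse_def)

lemma is_inverse_left_factor:
  assumes "is_inverse (x * y) w" "x * y = y * x"
  shows "is_inverse x (w * y)"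
proof (rule is_inverseI(2))
  show "w * y * x = 1" using assms by (simp add: is_inverse_def mult.assoc)
  show "x * (y * w) = 1" using assms(1) by (simp add: is_inverse_def mult.assoc)
qed

lemma is_inverse_commute:
  fixes x y z :: "'a::monoid_mult"
  assumes "is_inverse x y" "x * z = z * x"
  shows "y * z = z * y"
proof -
  have "y * z = y * (z * (x * y))" using assms(1) by (simp add: is_inverse_def)
  also have "\<dots> = y * (x * z) * y" using assms(2) by (simp add: mult.assoc)
  also have "\<dots> = z * y" using assms(1) by (simp add: is_inverse_def mult.assoc[symmetric])
  finally show ?thesis .
qed

text \<open>For commuting arguments, the complete homogeneous symmetric polynomial of degree
  \<open>m\<close> in two variables.\<close>

definition homog :: "'a::semiring_1 \<Rightarrow> 'a \<Rightarrow> nat \<Rightarrow> 'a" where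
  "homog a b m = (\<Sum>k\<le>m. a ^ k * b ^ (m - k))"

lemma homog_0: "homog a b 0 = 1"
  by (simp add: homog_def)

lemma homog_Suc: "homog a b (Suc m) = a * homog a b m + b ^ Suc m"
  by (simp add: homog_def sum.atMost_Suc_shift sum_distrib_left mult.assoc add.commute del: sum.atMost_Suc)

lemma homog_1: "homog a b (Suc 0) = a + b"
  by (simp add: homog_Suc homog_0)

text \<open>The generating function is 1 / ((1 - a t)(1 - b t)), and its denominator is this
  recursion. Only the sum and the product of \<open>a\<close> and \<open>b\<close> enter, which for
  conjugate factors are free of imaginary units.\<close>

lemma homog_rec:
  fixes a b :: "'a::ring_1"
  assumes "a * b = b * a"
  shows "homog a b (Suc (Suc m)) = (a + b) * homog a b (Suc m) - a * b * homog a b m"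
proof -
  have "b * homog a b (Suc m) - a * b * homog a b m = b ^ Suc (Suc m)"
    by (simp add: homog_Suc assms distrib_left mult.assoc[symmetric])
  then show ?thesis
    by (simp add: homog_Suc[of a b "Suc m"] distrib_right)
qed

lemma geometric_is_inverse:
  fixes w :: "'a::{real_normed_algebra_1, banach}"
  assumes "summable (\<lambda>n. norm (w ^ n))"
  shows "is_inverse (1 - w) (suminf (\<lambda>n. w ^ n))"
proof -
  have sm: "summable (\<lambda>n. w ^ n)" by (rule summable_norm_cancel[OF assms])
  have split: "suminf (\<lambda>n. w ^ n) = 1 + suminf (\<lambda>n. w ^ Suc n)"
    using suminf_split_head[OF sm] by simp
  have "suminf (\<lambda>n. w ^ Suc n) = w * suminf (\<lambda>n. w ^ n)"
    "suminf (\<lambda>n. w ^ Suc n) = suminf (\<lambda>n. w ^ n) * w"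
    using suminf_mult[OF sm, of w] suminf_mult2[OF sm, of w] by (simp_all add: power_commutes)
  then show ?thesis
    using split by (simp add: is_inverse_def left_diff_distrib right_diff_distrib)
qed

text \<open>\<open>(X * N) ^ n\<close> is \<open>(v / u) ^ n\<close> times the product of the two
  rescaled powers, so bounded rescaled powers already give a geometric majorant.\<close>

lemma summable_commuting_product:
  fixes X N :: "'a::real_normed_algebra_1"
  assumes XN: "X * N = N * X" and u: "0 < v" "v < u"
    and "Bseq (\<lambda>n. (u *\<^sub>R X) ^ n)" "Bseq (\<lambda>n. (N /\<^sub>R v) ^ n)"
  shows "summable (\<lambda>n. norm ((X * N) ^ n))"
proof -
  obtain K L where K: "K > 0" "\<And>n. norm ((u *\<^sub>R X) ^ n) \<le> K" and L: "\<And>n. norm ((N /\<^sub>R v) ^ n) \<le> L"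
    using assms(4,5) unfolding Bseq_def by metis
  have bound: "norm ((X * N) ^ n) \<le> K * L * (v / u) ^ n" for n
  proof -
    have "(v / u) ^ n *\<^sub>R ((u *\<^sub>R X) ^ n * (N /\<^sub>R v) ^ n) =
        ((v / u) ^ n * u ^ n * inverse v ^ n) *\<^sub>R (X ^ n * N ^ n)"
      by simp
    also have "(v / u) ^ n * u ^ n * inverse v ^ n = 1"
      using u by (simp flip: power_mult_distrib)
    finally have "(X * N) ^ n = (v / u) ^ n *\<^sub>R ((u *\<^sub>R X) ^ n * (N /\<^sub>R v) ^ n)"
      by (simp only: scaleR_one commuting_power_mult_distrib[OF XN])
    then have "norm ((X * N) ^ n) = (v / u) ^ n * norm ((u *\<^sub>R X) ^ n * (N /\<^sub>R v) ^ n)"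
      using u by (simp only: norm_scaleR) simp
    also have "\<dots> \<le> (v / u) ^ n * (K * L)"
      using u K by (intro mult_left_mono order_trans[OF norm_mult_ineq] mult_mono L) auto
    finally show ?thesis by (simp add: mult.commute)
  qed
  have "summable (\<lambda>n. K * L * (v / u) ^ n)"
    using u by (intro summable_mult summable_geometric) simp
  then show ?thesis
    by (rule summable_comparison_test'[where N = 0]) (simp only: real_norm_def abs_norm_cancel bound)
qed

text \<open>Clears denominators: in \<open>(X * Y) ^ (i + j) * (b ^ i * a ^ j)\<close> the factor
  \<open>b ^ i\<close> cancels \<open>Y ^ i\<close> and \<open>a ^ j\<close> cancels
  \<open>X ^ j\<close>, leaving \<open>X ^ i * Y ^ j\<close>. Thus powers of two separate resolvents
  become one power of the inverse pencil times a polynomial.\<close>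

lemma pencil_series_term:
  fixes a b X Y N :: "'a::semiring_1"
  assumes X: "is_inverse a X" and Y: "is_inverse b Y"
    and ab: "a * b = b * a" and aN: "a * N = N * a" and bN: "b * N = N * b"
  shows "X * (\<Sum>i\<le>k. (X * N) ^ i * (Y * N) ^ (k - i)) * Y = (X * Y) ^ Suc k * homog b a k * N ^ k"
proof -
  have XN: "X * N = N * X" and YN: "Y * N = N * Y"
    using is_inverse_commute X Y aN bN by blast+
  have Yb: "Y * a = a * Y" using is_inverse_commute[OF Y ab[symmetric]] .
  have XY: "X * Y = Y * X" using is_inverse_commute[OF X, of Y] Yb by simp
  have summand: "X * ((X * N) ^ i * (Y * N) ^ j) * Y = (X * Y) ^ Suc (i + j) * (b ^ i * a ^ j) * N ^ (i + j)"
    for i j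
  proof -
    have comm_pow: "p ^ m * q ^ n = q ^ n * p ^ m" if "p * q = q * p" for p q :: 'a and m n
      by (rule power_commuting_commutes, rule power_commuting_commutes[symmetric]) (simp add: that)
    have can: "p ^ n * q ^ n = 1" if "is_inverse p q" for p q :: 'a and n
      using that commuting_power_mult_distrib[of p q n] by (simp add: is_inverse_def)
    have "(X * Y) ^ (i + j) * (b ^ i * a ^ j) = X ^ (i + j) * (Y ^ (i + j) * b ^ i) * a ^ j"
      by (simp add: commuting_power_mult_distrib[OF XY] mult.assoc)
    also have "Y ^ (i + j) * b ^ i = Y ^ j"
      using can[OF is_inverse_sym[OF Y], of i] by (simp add: power_add add.commute[of i] mult.assoc)
    also have "X ^ (i + j) * Y ^ j * a ^ j = X ^ (i + j) * a ^ j * Y ^ j"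
      by (simp add: comm_pow[OF Yb] mult.assoc)
    also have "X ^ (i + j) * a ^ j = X ^ i"
      using can[OF is_inverse_sym[OF X], of j] by (simp add: power_add mult.assoc)
    finally have 1: "(X * Y) ^ (i + j) * (b ^ i * a ^ j) = X ^ i * Y ^ j" .
    have "X * ((X * N) ^ i * (Y * N) ^ j) * Y = X * (X ^ i * (N ^ i * Y ^ j) * (N ^ j * Y))"
      by (simp add: commuting_power_mult_distrib[OF XN] commuting_power_mult_distrib[OF YN] mult.assoc)
    also have "N ^ i * Y ^ j = Y ^ j * N ^ i"
      by (rule comm_pow) (rule YN[symmetric])
    also have "N ^ j * Y = Y * N ^ j"
      using comm_pow[OF YN[symmetric], of j 1] by simp
    also have "X * (X ^ i * (Y ^ j * N ^ i) * (Y * N ^ j)) = X * (X ^ i * (Y ^ j * (N ^ i * Y) * N ^ j))"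
      by (simp add: mult.assoc)
    also have "N ^ i * Y = Y * N ^ i"
      using comm_pow[OF YN[symmetric], of i 1] by simp
    also have "X * (X ^ i * (Y ^ j * (Y * N ^ i) * N ^ j)) = X * (X ^ i * (Y ^ j * Y)) * N ^ (i + j)"
      by (simp add: power_add mult.assoc)
    also have "X * (X ^ i * (Y ^ j * Y)) = X * ((X ^ i * Y) * Y ^ j)"
      by (simp add: power_commutes mult.assoc)
    also have "X ^ i * Y = Y * X ^ i"
      using comm_pow[OF XY, of i 1] by simp
    also have "X * (Y * X ^ i * Y ^ j) = (X * Y) * ((X * Y) ^ (i + j) * (b ^ i * a ^ j))"
      unfolding 1 by (simp add: mult.assoc)
    finally show ?thesis by (simp add: mult.assoc)
  qed
  show ?thesis
    unfolding homog_def sum_distrib_left sum_distrib_right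
  proof (rule sum.cong[OF refl])
    fix i assume "i \<in> {..k}"
    then show "X * ((X * N) ^ i * (Y * N) ^ (k - i)) * Y = (X * Y) ^ Suc k * (b ^ i * a ^ (k - i)) * N ^ k"
      using summand[of i "k - i"] by simp
  qed
qed

text \<open>The product of \<open>z - X\<close> and its conjugate, multiplied out. The coefficients
  are real and the same for \<open>z\<close> and \<open>cnj z\<close>.\<close>

definition pencil :: "complex \<Rightarrow> 'a::real_algebra_1 \<Rightarrow> 'a" where
  "pencil z X = X * X - (2 * Re z) *\<^sub>R X + (cmod z)\<^sup>2 *\<^sub>R 1"

context complex_scalars
begin

interpretation c: bounded_linear c by (rule bounded_linear_c)

lemma pencil_factor:
  assumes comm: "\<And>x. c x * X = X * c x"
  shows "(c z - X) * (c (cnj z) - X) = pencil z X"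
proof -
  have 1: "c z * c (cnj z) = (cmod z)\<^sup>2 *\<^sub>R 1"
    by (simp only: complex_norm_square[symmetric] c_mult[symmetric] c_of_real)
      (simp add: scaleR_conv_of_real)
  have 2: "c z + c (cnj z) = of_real (2 * Re z)"
    by (simp only: complex_add_cnj c.add[symmetric] c_of_real)
  have "(c z - X) * (c (cnj z) - X) = c z * c (cnj z) - (c z + c (cnj z)) * X + X * X"
    by (simp add: algebra_simps comm)
  then show ?thesis
    unfolding 1 2 by (simp add: pencil_def scaleR_conv_of_real algebra_simps)
qed

lemma pencil_factor':
  assumes comm: "\<And>x. c x * X = X * c x"
  shows "(c (cnj z) - X) * (c z - X) = pencil z X"
  using pencil_factor[OF comm, of "cnj z"] by (simp add: pencil_def)

lemma pencil_invertible_factor: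
  assumes comm: "\<And>x. c x * X = X * c x" and "is_inverse (pencil z X) Y"
  shows "is_inverse (c z - X) (Y * (c (cnj z) - X))"
  by (rule is_inverse_left_factor)
    (simp_all add: pencil_factor pencil_factor' comm assms(2))

text \<open>\<open>1 - c x * X = (c (z - x) - T) * X\<close>, so the disc of radius \<open>R\<close>
  about \<open>z\<close> on which \<open>T\<close> has a resolvent becomes the disc about 0 required
  for \<open>X\<close>.\<close>

lemma resolvent_power_bounded:
  assumes comm: "\<And>x. c x * T = T * c x"
    and X: "is_inverse (c z - T) X"
    and inv: "\<And>x. cmod (x - z) \<le> R \<Longrightarrow> \<exists>Y. is_inverse (c x - T) Y"
    and u: "0 \<le> u" "u < R"
  shows "Bseq (\<lambda>n. (u *\<^sub>R X) ^ n)"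
proof (rule convergent_imp_Bseq, rule convergentI, rule power_tendsto_zero[OF _ _ u])
  show "c x * X = X * c x" for x
    by (rule is_inverse_commute[OF X, symmetric])
      (simp add: left_diff_distrib right_diff_distrib comm mult.commute flip: c_mult)
  show "\<exists>Y. Y * (1 - c x * X) = 1 \<and> (1 - c x * X) * Y = 1" if x: "cmod x \<le> R" for x
  proof -
    obtain Y where Y: "is_inverse (c (z - x) - T) Y"
      using inv[of "z - x"] x by auto
    have "1 - c x * X = (c (z - x) - T) * X"
      using X by (simp add: is_inverse_def c.diff algebra_simps)
    with is_inverse_mult[OF Y is_inverse_sym[OF X]] show ?thesis
      by (auto simp: is_inverse_def)
  qed
qed

text \<open>\<open>1 - c x * X = c x * (c (inverse x) - X)\<close> for nonzero \<open>x\<close>, so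
  inversion carries the exterior of the \<epsilon>-disc to the disc of radius
  \<open>inverse \<epsilon>\<close>.\<close>

lemma power_bounded:
  assumes comm: "\<And>x. c x * X = X * c x"
    and inv: "\<And>x. cmod x \<ge> \<epsilon> \<Longrightarrow> \<exists>Y. is_inverse (c x - X) Y"
    and u: "0 < \<epsilon>" "\<epsilon> < u"
  shows "Bseq (\<lambda>n. (X /\<^sub>R u) ^ n)"
proof (rule convergent_imp_Bseq, rule convergentI, rule power_tendsto_zero[OF comm])
  show "0 \<le> inverse u" "inverse u < inverse \<epsilon>"
    using u by simp_all
  show "\<exists>Y. Y * (1 - c x * X) = 1 \<and> (1 - c x * X) * Y = 1" if x: "cmod x \<le> inverse \<epsilon>" for x
  proof (cases "x = 0")
    case False
    then have "cmod (inverse x) \<ge> \<epsilon>"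
      using le_imp_inverse_le[OF x] by (simp add: norm_inverse)
    then obtain Y where Y: "is_inverse (c (inverse x) - X) Y"
      using inv by auto
    have ix: "is_inverse (c x) (c (inverse x))"
      using False by (simp add: is_inverse_def flip: c_mult)
    have "1 - c x * X = c x * (c (inverse x) - X)"
      using ix by (simp add: is_inverse_def right_diff_distrib)
    with is_inverse_mult[OF ix Y] show ?thesis
      by (auto simp: is_inverse_def)
  qed (auto simp: c.zero)
qed

lemma pencil_perturbation_series:
  assumes comm: "\<And>x. c x * T = T * c x" "\<And>x. c x * N = N * c x" and TN: "T * N = N * T"
    and \<epsilon>: "0 < \<epsilon>" "\<epsilon> < R"
    and T: "\<And>x. cmod (x - z) \<le> R \<Longrightarrow> \<exists>Y. is_inverse (pencil x T) Y"
    and N: "\<And>x. cmod x \<ge> \<epsilon> \<Longrightarrow> \<exists>Y. is_inverse (pencil x N) Y"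
    and Q: "is_inverse (pencil z T) Q"
  obtains S where "is_inverse (pencil z (T + N)) S"
    "(\<lambda>m. Q ^ Suc m * homog (c (cnj z) - T) (c z - T) m * N ^ m) sums S"
proof -
  define a b where "a = c z - T" and "b = c (cnj z) - T"
  have invT: "\<exists>Y. is_inverse (c x - T) Y" if "cmod (x - z) \<le> R" for x
    using T[OF that] pencil_invertible_factor[OF comm(1)] by blast
  \<comment> \<open>The pencil does not distinguish \<open>x\<close> from \<open>cnj x\<close>, so
    the disc about \<open>z\<close> can be reflected.\<close>
  have invT': "\<exists>Y. is_inverse (c x - T) Y" if "cmod (x - cnj z) \<le> R" for x
  proof -
    have "cmod (cnj x - z) \<le> R"
      using that by (metis complex_cnj_cnj complex_cnj_diff complex_mod_cnj)
    then obtain Y where "is_inverse (pencil x T) Y"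
      using T[of "cnj x"] by (auto simp: pencil_def)
    then show ?thesis using pencil_invertible_factor[OF comm(1)] by blast
  qed
  have invN: "\<exists>Y. is_inverse (c x - N) Y" if "cmod x \<ge> \<epsilon>" for x
    using N[OF that] pencil_invertible_factor[OF comm(2)] by blast
  obtain X Y where X: "is_inverse a X" and Y: "is_inverse b Y"
    using invT[of z] invT'[of "cnj z"] \<epsilon> unfolding a_def b_def by auto
  have ab: "a * b = b * a"
    unfolding a_def b_def using pencil_factor[OF comm(1)] pencil_factor'[OF comm(1)] by simp
  have aN: "a * N = N * a" and bN: "b * N = N * b"
    by (simp_all add: a_def b_def left_diff_distrib right_diff_distrib comm TN)
  have XN: "X * N = N * X" and YN: "Y * N = N * Y"
    using is_inverse_commute X Y aN bN by blast+
  \<comment> \<open>Two radii strictly inside the gap: \<open>v\<close> for the powers of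
    \<open>N\<close>, \<open>u\<close> for those of the resolvents.\<close>
  define u v where "u = (\<epsilon> + 2 * R) / 3" and "v = (2 * \<epsilon> + R) / 3"
  have uv: "\<epsilon> < v" "v < u" "u < R" "0 < v" "0 \<le> u"
    using \<epsilon> by (auto simp: u_def v_def field_simps)
  have BN: "Bseq (\<lambda>n. (N /\<^sub>R v) ^ n)"
    by (rule power_bounded[OF comm(2) invN \<epsilon>(1) uv(1)])
  have sX: "summable (\<lambda>n. norm ((X * N) ^ n))"
    by (rule summable_commuting_product[OF XN uv(4,2) _ BN])
      (rule resolvent_power_bounded[OF comm(1) X[unfolded a_def] invT uv(5,3)])
  have sY: "summable (\<lambda>n. norm ((Y * N) ^ n))"
    by (rule summable_commuting_product[OF YN uv(4,2) _ BN])
      (rule resolvent_power_bounded[OF comm(1) Y[unfolded b_def] invT' uv(5,3)])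
  define P P' where "P = suminf (\<lambda>n. (X * N) ^ n)" and "P' = suminf (\<lambda>n. (Y * N) ^ n)"
  have P: "is_inverse (1 - X * N) P" and P': "is_inverse (1 - Y * N) P'"
    unfolding P_def P'_def by (intro geometric_is_inverse sX sY)+
  \<comment> \<open>Here the geometric sum stands on the right, in \<open>YP\<close> on the left. In
    the product of the two inverses the sums are then adjacent, as the Cauchy product
    requires.\<close>
  have XP: "is_inverse (a - N) (X * P)"
  proof -
    have 1: "P * X * (a - N) = 1"
      using X P by (simp add: is_inverse_def mult.assoc right_diff_distrib)
    have 2: "(a - N) * (X * P) = 1"
      using X P XN by (simp add: is_inverse_def mult.assoc[symmetric] left_diff_distrib)
    show ?thesis using is_inverseI[OF 1 2] by simp
  qed
  have YP: "is_inverse (b - N) (P' * Y)"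
  proof -
    have 1: "P' * Y * (b - N) = 1"
      using Y P' by (simp add: is_inverse_def mult.assoc right_diff_distrib)
    have 2: "(b - N) * (Y * P') = 1"
      using Y P' YN by (simp add: is_inverse_def mult.assoc[symmetric] left_diff_distrib)
    show ?thesis by (rule is_inverseI(2)[OF 1 2])
  qed
  have commTN: "c x * (T + N) = (T + N) * c x" for x
    by (simp add: comm distrib_left distrib_right)
  have "pencil z (T + N) = (b - N) * (a - N)"
    unfolding a_def b_def diff_diff_add by (rule pencil_factor'[OF commTN, symmetric])
  then have inv: "is_inverse (pencil z (T + N)) (X * P * (P' * Y))"
    using is_inverse_mult[OF YP XP] by (simp only:)
  have "pencil z T = b * a"
    unfolding a_def b_def by (rule pencil_factor'[OF comm(1), symmetric])
  then have "is_inverse (pencil z T) (X * Y)"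
    using is_inverse_mult[OF Y X] by (simp only:)
  then have XYQ: "X * Y = Q" by (rule is_inverse_unique) (rule Q)
  have "(\<lambda>k. X * (\<Sum>i\<le>k. (X * N) ^ i * (Y * N) ^ (k - i)) * Y) sums (X * (P * P') * Y)"
    unfolding P_def P'_def by (intro sums_mult sums_mult2 Cauchy_product_sums sX sY)
  then have "(\<lambda>k. Q ^ Suc k * homog b a k * N ^ k) sums (X * P * (P' * Y))"
    unfolding pencil_series_term[OF X Y ab aN bN] XYQ by (simp add: mult.assoc)
  with inv show thesis by (intro that) (simp_all add: a_def b_def)
qed

end

section \<open>The Banach algebra of endomorphisms\<close>

text \<open>A unital normed algebra needs \<open>norm 1 = 1\<close>, hence a nonzero underlying
  space; \<open>perfect_space\<close> guarantees this, and a factor \<open>real\<close> provides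
  it.\<close>

instance prod :: (topological_space, perfect_space) perfect_space
proof
  fix z :: "'a \<times> 'b"
  show "\<not> open {z}"
    using open_image_snd[of "{z}"] not_open_singleton[of "snd z"] by auto
qed

text \<open>A type with a single parameter for source and target, so that composition can be the
  multiplication of a type class.\<close>

typedef (overloaded) ('a::real_normed_vector) endo = "UNIV :: ('a \<Rightarrow>\<^sub>L 'a) set"
  morphisms endo_fun Endo ..

setup_lifting type_definition_endo

lemma endo_eqI: "(\<And>x. endo_fun a x = endo_fun b x) \<Longrightarrow> a = b"
  by transfer (rule blinfun_eqI)

instantiation endo :: (real_normed_vector) real_normed_vector
begin

lift_definition zero_endo :: "'a endo" is 0 .
lift_definition plus_endo :: "'a endo \<Rightarrow> 'a endo \<Rightarrow> 'a endo" is "(+)" .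
lift_definition minus_endo :: "'a endo \<Rightarrow> 'a endo \<Rightarrow> 'a endo" is "(-)" .
lift_definition uminus_endo :: "'a endo \<Rightarrow> 'a endo" is uminus .
lift_definition scaleR_endo :: "real \<Rightarrow> 'a endo \<Rightarrow> 'a endo" is "(*\<^sub>R)" .
lift_definition norm_endo :: "'a endo \<Rightarrow> real" is norm .
definition sgn_endo :: "'a endo \<Rightarrow> 'a endo" where "sgn_endo x = inverse (norm x) *\<^sub>R x"
definition dist_endo :: "'a endo \<Rightarrow> 'a endo \<Rightarrow> real" where "dist_endo x y = norm (x - y)"
definition uniformity_endo :: "('a endo \<times> 'a endo) filter" where
  "uniformity_endo = (INF e\<in>{0<..}. principal {(x, y). dist x y < e})"
definition open_endo :: "'a endo set \<Rightarrow> bool" where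
  "open_endo S = (\<forall>x\<in>S. \<forall>\<^sub>F (x', y) in uniformity. x' = x \<longrightarrow> y \<in> S)"

instance
  apply standard
  unfolding dist_endo_def open_endo_def sgn_endo_def uniformity_endo_def
  by (rule refl | (transfer, simp add: algebra_simps norm_triangle_ineq))+

end

instance endo :: (banach) banach
proof
  fix X :: "nat \<Rightarrow> 'a endo"
  assume "Cauchy X"
  then have "Cauchy (\<lambda>n. endo_fun (X n))"
    by (simp add: Cauchy_def dist_norm norm_endo.rep_eq minus_endo.rep_eq)
  then obtain L where "(\<lambda>n. endo_fun (X n)) \<longlonglongrightarrow> L"
    by (auto simp: Cauchy_convergent_iff convergent_def)
  then have "X \<longlonglongrightarrow> Endo L"
    by (simp add: LIMSEQ_def dist_norm norm_endo.rep_eq minus_endo.rep_eq Endo_inverse)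
  then show "convergent X" by (auto simp: convergent_def)
qed

instantiation endo :: ("{real_normed_vector, perfect_space}") real_normed_algebra_1
begin

lift_definition one_endo :: "'a endo" is id_blinfun .
lift_definition times_endo :: "'a endo \<Rightarrow> 'a endo \<Rightarrow> 'a endo" is "(o\<^sub>L)" .

instance
proof
  fix a b c :: "'a endo" and r :: real
  note rep = one_endo.rep_eq times_endo.rep_eq plus_endo.rep_eq scaleR_endo.rep_eq
    blinfun.bilinear_simps
  show "a * b * c = a * (b * c)" "(a + b) * c = a * c + b * c" "a * (b + c) = a * b + a * c"
    "r *\<^sub>R a * b = r *\<^sub>R (a * b)" "a * r *\<^sub>R b = r *\<^sub>R (a * b)" "1 * a = a" "a * 1 = a"
    by (rule endo_eqI, simp add: rep)+
  show n1: "norm (1 :: 'a endo) = 1"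
    by transfer simp
  show "(0 :: 'a endo) \<noteq> 1"
    using n1 by (metis norm_zero zero_neq_one)
  show "norm (a * b) \<le> norm a * norm b"
    by transfer (rule norm_blinfun_compose)
qed

end

lemma endo_fun_simps:
  "endo_fun 1 x = x" "endo_fun (a * b) x = endo_fun a (endo_fun b x)"
  "endo_fun (c + d) y = endo_fun c y + endo_fun d y"
  "endo_fun (c - d) y = endo_fun c y - endo_fun d y"
  "endo_fun (r *\<^sub>R c) y = r *\<^sub>R endo_fun c y"
  by (simp_all add: one_endo.rep_eq times_endo.rep_eq plus_endo.rep_eq minus_endo.rep_eq
      scaleR_endo.rep_eq blinfun.bilinear_simps)

section \<open>The star products as real polynomials\<close>

lemma op_power_0: "op_power T 0 = id_blinfun"
  by (simp add: op_power_def)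

lemma op_power_Suc: "op_power T (Suc k) = T o\<^sub>L op_power T k"
  by (simp add: op_power_def)

lemma op_power_Suc_apply: "op_power T (Suc k) x = op_power T k (T x)"
  by (induction k) (simp_all add: op_power_0 op_power_Suc)

lemma op_power_add_apply: "op_power T (j + k) x = op_power T j (op_power T k x)"
  by (induction j) (simp_all add: op_power_0 op_power_Suc)

lemma S_pencil_apply:
  "S_pencil s T x = T (T x) - (2 * fst s) *\<^sub>R T x + (norm s)\<^sup>2 *\<^sub>R x"
  by (simp add: S_pencil_def numeral_2_eq_2 op_power_Suc op_power_0 blinfun.bilinear_simps)

lemma lmult_apply:
  "lmult a v = (\<chi> C. \<Sum>A\<in>UNIV. (csign A (sym_diff A C) * coeff a A) *\<^sub>R (v $ sym_diff A C))"
  by (simp add: lmult.rep_eq sum_sym_diff)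

lemma lmult_add: "lmult (a + b) v = lmult a v + lmult b v"
  by (simp add: lmult_apply vec_eq_iff plus_clifford.rep_eq algebra_simps sum.distrib)

lemma lmult_scaleR: "lmult (r *\<^sub>R a) v = r *\<^sub>R lmult a v"
  by (simp add: lmult_apply vec_eq_iff scaleR_clifford.rep_eq scaleR_sum_right mult_ac)

lemma lmult_0: "lmult 0 v = 0"
  using lmult_scaleR[of 0 0 v] by simp

lemma lmult_1:
  fixes v :: "'v::real_normed_vector ^ 'n::{finite,linorder} set"
  shows "lmult 1 v = v"
proof -
  have "(\<Sum>A\<in>UNIV. (csign A (sym_diff A C) * coeff 1 A) *\<^sub>R (v $ sym_diff A C)) =
      (\<Sum>A::'n set\<in>UNIV. if A = {} then v $ C else 0)" for C
    by (rule sum.cong) (auto simp: one_clifford.rep_eq)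
  then show ?thesis by (simp add: lmult_apply vec_eq_iff)
qed

lemma cpoly_eval_apply:
  assumes "finite K" "Poly_Mapping.keys P \<subseteq> K"
  shows "cpoly_eval T P v = (\<Sum>k\<in>K. op_power T k (lmult (Poly_Mapping.lookup P k) v))"
  unfolding cpoly_eval_def blinfun.sum_left blinfun_apply_blinfun_compose
  using assms by (intro sum.mono_neutral_left) (auto simp: lmult_0 in_keys_iff)

lemma cpoly_eval_add: "cpoly_eval T (P + Q) v = cpoly_eval T P v + cpoly_eval T Q v"
proof -
  let ?K = "Poly_Mapping.keys P \<union> Poly_Mapping.keys Q"
  have "Poly_Mapping.keys (P + Q) \<subseteq> ?K" by (rule Poly_Mapping.keys_add)
  then show ?thesis
    by (simp add: cpoly_eval_apply[of ?K] lookup_add lmult_add blinfun.add_right sum.distrib)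
qed

lemma cpoly_eval_0: "cpoly_eval T 0 v = 0"
  by (simp add: cpoly_eval_def)

lemma cpoly_eval_sum: "cpoly_eval T (\<Sum>i\<in>I. P i) v = (\<Sum>i\<in>I. cpoly_eval T (P i) v)"
  by (induction I rule: infinite_finite_induct) (simp_all add: cpoly_eval_0 cpoly_eval_add)

lemma lookup_single_mult:
  fixes P :: "('n::{finite,linorder}) cpoly"
  shows "Poly_Mapping.lookup (Poly_Mapping.single k a * P) m =
    (if k \<le> m then a * Poly_Mapping.lookup P (m - k) else 0)"
proof -
  have "Poly_Mapping.lookup (Poly_Mapping.single k a * P) m =
      (\<Sum>i\<le>m. if i = k then a * Poly_Mapping.lookup P (m - k) else 0)"
    unfolding lookup_cpoly_times by (rule sum.cong) (auto simp: lookup_single when_def)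
  then show ?thesis by simp
qed

text \<open>A real coefficient acts as a scalar and moves past the powers of \<open>T\<close>. This
  is the restricted multiplicativity that evaluation retains.\<close>

lemma cpoly_eval_real_monomial_mult:
  "cpoly_eval T (Poly_Mapping.single k (of_real r) * P) v = r *\<^sub>R op_power T k (cpoly_eval T P v)"
proof -
  let ?K = "(\<lambda>j. k + j) ` Poly_Mapping.keys P"
  have sub: "Poly_Mapping.keys (Poly_Mapping.single k (of_real r) * P) \<subseteq> ?K"
  proof
    fix m assume "m \<in> Poly_Mapping.keys (Poly_Mapping.single k (of_real r) * P)"
    then have "k \<le> m" "m - k \<in> Poly_Mapping.keys P"
      by (auto simp: in_keys_iff lookup_single_mult split: if_splits)
    then show "m \<in> ?K" by (auto intro!: image_eqI[of _ _ "m - k"])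
  qed
  have "cpoly_eval T (Poly_Mapping.single k (of_real r) * P) v =
      (\<Sum>j\<in>Poly_Mapping.keys P. op_power T (k + j) (lmult (r *\<^sub>R Poly_Mapping.lookup P j) v))"
    by (subst cpoly_eval_apply[OF _ sub])
      (simp_all add: sum.reindex lookup_single_mult scaleR_conv_of_real)
  also have "\<dots> = r *\<^sub>R op_power T k (cpoly_eval T P v)"
    by (simp add: cpoly_eval_apply[of "Poly_Mapping.keys P"] op_power_add_apply lmult_scaleR
        blinfun.bilinear_simps scaleR_sum_right)
  finally show ?thesis .
qed

lemma paravector_conj:
  fixes s :: "real \<times> (real ^ 'n::{finite,linorder})"
  shows "paravector (conj_point s) + paravector s = of_real (2 * fst s)"
    and "paravector (conj_point s) * paravector s = of_real ((norm s)\<^sup>2)"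
proof -
  define v :: "'n clifford" where "v = (\<Sum>j\<in>UNIV. (snd s $ j) *\<^sub>R cgen j)"
  have p: "paravector s = of_real (fst s) + v" "paravector (conj_point s) = of_real (fst s) - v"
    by (simp_all add: paravector_def conj_point_def v_def of_real_def sum_negf)
  show "paravector (conj_point s) + paravector s = of_real (2 * fst s)"
    unfolding p mult_2 of_real_add by simp
  have vv: "v * v = (\<Sum>i\<in>UNIV. \<Sum>j\<in>UNIV. (snd s $ j * snd s $ i) *\<^sub>R (cgen i * cgen j))"
    unfolding v_def sum_product
    by (intro sum.cong refl) (simp only: mult_scaleR_left mult_scaleR_right scaleR_scaleR)
  have "v * v = (\<Sum>i\<in>UNIV. \<Sum>j\<in>UNIV. (snd s $ j * snd s $ i) *\<^sub>R (cgen j * cgen i))"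
    unfolding vv
    by (subst sum.swap, intro sum.cong refl arg_cong2[where f = scaleR]) (rule mult.commute)
  \<comment> \<open>Adding the double sum to its transpose produces anticommutators, of which only
    the diagonal survives.\<close>
  with vv have "2 *\<^sub>R (v * v) = (\<Sum>i\<in>UNIV. \<Sum>j\<in>UNIV.
      (snd s $ j * snd s $ i) *\<^sub>R (cgen i * cgen j + cgen j * cgen i))"
    by (simp only: scaleR_2 scaleR_add_right sum.distrib)
  also have "\<dots> = (\<Sum>i\<in>UNIV. \<Sum>j\<in>UNIV. if i = j then (snd s $ i)\<^sup>2 *\<^sub>R (- 2) else 0)"
    unfolding cgen_anticommute by (intro sum.cong refl) (simp add: power2_eq_square)
  also have "\<dots> = (\<Sum>i\<in>UNIV. (snd s $ i)\<^sup>2) *\<^sub>R (- 2)"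
    by (simp add: scaleR_sum_left sum_negf)
  also have "(\<Sum>i\<in>UNIV. (snd s $ i)\<^sup>2) = (norm (snd s))\<^sup>2"
    by (simp add: norm_vec_def L2_set_def sum_nonneg)
  also have "(norm (snd s))\<^sup>2 *\<^sub>R (- 2 :: 'n clifford) = 2 *\<^sub>R - of_real ((norm (snd s))\<^sup>2)"
  proof -
    have two: "(- 2 :: 'n clifford) = (- 2) *\<^sub>R 1" by (simp add: scaleR_conv_of_real)
    show ?thesis
      unfolding two of_real_def scaleR_minus_left[symmetric] scaleR_scaleR
      by (rule arg_cong[where f = "\<lambda>r. r *\<^sub>R 1"]) simp
  qed
  finally have "v * v = - of_real ((norm (snd s))\<^sup>2)"
    by (simp only: real_vector.scale_cancel_left) simp
  moreover have "(norm s)\<^sup>2 = (fst s)\<^sup>2 + (norm (snd s))\<^sup>2"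
    by (simp add: norm_prod_def)
  moreover have "of_real (fst s) * v = v * of_real (fst s)"
    by (simp add: of_real_def)
  ultimately show "paravector (conj_point s) * paravector s = of_real ((norm s)\<^sup>2)"
    by (simp add: p algebra_simps power2_eq_square)
qed

lemma linear_cpoly_conj_add:
  "linear_cpoly (conj_point s) + linear_cpoly s =
    Poly_Mapping.single 0 (of_real (2 * fst s)) + Poly_Mapping.single 1 (of_real (- 2))"
proof -
  have "linear_cpoly (conj_point s) + linear_cpoly s =
      Poly_Mapping.single 0 (paravector (conj_point s) + paravector s) + Poly_Mapping.single 1 (- 1 + - 1)"
    unfolding linear_cpoly_def Poly_Mapping.single_add single_uminus by simp
  then show ?thesis by (simp add: paravector_conj)
qed

lemma linear_cpoly_conj_mult:
  "linear_cpoly (conj_point s) * linear_cpoly s =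
    Poly_Mapping.single 2 (of_real 1) + Poly_Mapping.single 1 (of_real (- 2 * fst s)) +
    Poly_Mapping.single 0 (of_real ((norm s)\<^sup>2))"
proof -
  have "linear_cpoly (conj_point s) * linear_cpoly s =
      Poly_Mapping.single 2 1 + Poly_Mapping.single 1 (- (paravector (conj_point s) + paravector s)) +
      Poly_Mapping.single 0 (paravector (conj_point s) * paravector s)"
    unfolding linear_cpoly_def Poly_Mapping.single_add single_uminus
    by (simp add: left_diff_distrib right_diff_distrib mult_single numeral_2_eq_2)
  then show ?thesis by (simp add: paravector_conj)
qed

text \<open>The product depends on \<open>s\<close> only through \<open>fst s\<close> and
  \<open>norm s\<close>, which conjugation preserves.\<close>

lemma linear_cpoly_conj_commute:
  "linear_cpoly (conj_point s) * linear_cpoly s = linear_cpoly s * linear_cpoly (conj_point s)"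
proof -
  have "conj_point (conj_point s) = s" "norm (conj_point s) = norm s" "fst (conj_point s) = fst s"
    by (simp_all add: conj_point_def norm_prod_def)
  then show ?thesis
    using linear_cpoly_conj_mult[of s] linear_cpoly_conj_mult[of "conj_point s"] by simp
qed

abbreviation "homog_cpoly s \<equiv> homog (linear_cpoly (conj_point s)) (linear_cpoly s)"

lemma cpoly_eval_pencil_mult:
  "cpoly_eval T (linear_cpoly (conj_point s) * linear_cpoly s * P) v =
    S_pencil s T (cpoly_eval T P v)"
  unfolding linear_cpoly_conj_mult distrib_right cpoly_eval_add cpoly_eval_real_monomial_mult
  by (simp add: S_pencil_apply op_power_Suc op_power_0 numeral_2_eq_2)

lemma cpoly_eval_trace_mult:
  "cpoly_eval T ((linear_cpoly (conj_point s) + linear_cpoly s) * P) v =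
    (2 * fst s) *\<^sub>R cpoly_eval T P v - 2 *\<^sub>R T (cpoly_eval T P v)"
  unfolding linear_cpoly_conj_add distrib_right cpoly_eval_add cpoly_eval_real_monomial_mult
  by (simp add: op_power_Suc op_power_0)

lemma cpoly_eval_homog_0: "cpoly_eval T (homog_cpoly s 0) v = v"
proof -
  have "homog_cpoly s 0 = Poly_Mapping.single 0 1" by (simp add: homog_0 single_one)
  moreover have "cpoly_eval T (Poly_Mapping.single 0 1) v = v"
    by (subst cpoly_eval_apply[of "{0}"]) (simp_all add: op_power_0 lmult_1)
  ultimately show ?thesis by simp
qed

lemma cpoly_eval_homog_1:
  "cpoly_eval T (homog_cpoly s (Suc 0)) v = (2 * fst s) *\<^sub>R v - 2 *\<^sub>R T v"
  using cpoly_eval_trace_mult[of T s "homog_cpoly s 0" v]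
  by (simp add: homog_1 homog_0[of "linear_cpoly (conj_point s)" "linear_cpoly s"]
      cpoly_eval_homog_0[unfolded homog_0])

lemma cpoly_eval_homog_rec:
  "cpoly_eval T (homog_cpoly s (Suc (Suc m))) v =
    (2 * fst s) *\<^sub>R cpoly_eval T (homog_cpoly s (Suc m)) v
    - 2 *\<^sub>R T (cpoly_eval T (homog_cpoly s (Suc m)) v)
    - S_pencil s T (cpoly_eval T (homog_cpoly s m) v)"
proof -
  let ?a = "linear_cpoly (conj_point s)" and ?b = "linear_cpoly s"
  have "homog_cpoly s (Suc (Suc m)) + ?a * ?b * homog_cpoly s m = (?a + ?b) * homog_cpoly s (Suc m)"
    by (simp only: homog_rec[OF linear_cpoly_conj_commute] diff_add_cancel)
  then have "cpoly_eval T (homog_cpoly s (Suc (Suc m))) v +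
      cpoly_eval T (?a * ?b * homog_cpoly s m) v =
      cpoly_eval T ((?a + ?b) * homog_cpoly s (Suc m)) v"
    by (simp only: cpoly_eval_add[symmetric])
  then show ?thesis
    unfolding cpoly_eval_pencil_mult cpoly_eval_trace_mult by (simp add: eq_diff_eq)
qed

text \<open>All summands share the factor
  \<open>linear_cpoly (conj_point s) * linear_cpoly s\<close>. It evaluates to the pencil and
  cancels one of the \<open>m + 2\<close> inverses.\<close>

lemma sum_SL_star_apply:
  assumes "op_invertible (S_pencil s T)"
  shows "(\<Sum>k\<le>m. SL_star s T (k + 1) (m - k + 1)) v =
    op_power (op_inverse (S_pencil s T)) (Suc m) (cpoly_eval T (homog_cpoly s m) v)"
proof -
  let ?a = "linear_cpoly (conj_point s)" and ?b = "linear_cpoly s"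
  let ?Q = "op_inverse (S_pencil s T)"
  have mono: "?a ^ (k + 1) * ?b ^ (m - k + 1) = ?a * ?b * (?a ^ k * ?b ^ (m - k))" for k
  proof -
    have "?a ^ k * ?b = ?b * ?a ^ k"
      by (rule power_commuting_commutes) (rule linear_cpoly_conj_commute)
    then show ?thesis
      by (simp add: mult.assoc[symmetric]) (simp add: mult.assoc)
  qed
  have "(\<Sum>k\<le>m. SL_star s T (k + 1) (m - k + 1)) v =
      (\<Sum>k\<le>m. op_power ?Q (m + 2) (cpoly_eval T (?a * ?b * (?a ^ k * ?b ^ (m - k))) v))"
    unfolding blinfun.sum_left SL_star_def blinfun_apply_blinfun_compose mono
    by (intro sum.cong refl) (simp add: algebra_simps)
  also have "\<dots> = op_power ?Q (m + 2) (cpoly_eval T (?a * ?b * homog_cpoly s m) v)"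
    by (simp only: homog_def sum_distrib_left cpoly_eval_sum blinfun.sum_right)
  also have "\<dots> = op_power ?Q (Suc m) (?Q (S_pencil s T (cpoly_eval T (homog_cpoly s m) v)))"
    by (simp only: cpoly_eval_pencil_mult add_2_eq_Suc' op_power_Suc_apply)
  also have "?Q (S_pencil s T w) = w" for w
    using op_inverse[OF assms] unfolding is_op_inverse_def
    by (metis blinfun_apply_blinfun_compose blinfun_apply_id_blinfun)
  finally show ?thesis .
qed

section \<open>Complexification\<close>

text \<open>
  The factors \<open>\<real>\<close> keep the operator algebra nontrivial when \<open>'w\<close> is the zero space, for which
  \<open>1 = 0\<close>. In the proof the operators act on them by scalars with harmless spectrum.
\<close>

type_synonym 'w double = "('w \<times> real) \<times> ('w \<times> real)"

text \<open>Multiplication by the imaginary unit, a pair standing for real and imaginary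
  part.\<close>

definition rot :: "('w::real_normed_vector) double endo" where
  "rot = Endo (Blinfun (\<lambda>z. (- snd z, fst z)))"

definition cscalar :: "complex \<Rightarrow> ('w::real_normed_vector) double endo" where
  "cscalar z = Re z *\<^sub>R 1 + Im z *\<^sub>R rot"

definition double_op :: "real \<Rightarrow> ('w \<Rightarrow>\<^sub>L 'w) \<Rightarrow> ('w::real_normed_vector) double endo" where
  "double_op r X = Endo (Blinfun (\<lambda>z.
    ((X (fst (fst z)), r * snd (fst z)), (X (fst (snd z)), r * snd (snd z)))))"

lemma endo_fun_rot: "endo_fun rot (x, y) = (- y, x)"
proof -
  have "bounded_linear (\<lambda>z :: 'a double. (- snd z, fst z))"
    by (intro bounded_linear_Pair bounded_linear_minus bounded_linear_fst bounded_linear_snd)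
  then show ?thesis by (simp add: rot_def Endo_inverse bounded_linear_Blinfun_apply)
qed

lemma endo_fun_double_op: "endo_fun (double_op r X) ((x, p), (y, q)) = ((X x, r * p), (X y, r * q))"
proof -
  have "bounded_linear (\<lambda>z :: 'a double.
      ((X (fst (fst z)), r * snd (fst z)), (X (fst (snd z)), r * snd (snd z))))"
    by (intro bounded_linear_Pair bounded_linear_blinfun_apply bounded_linear_const_mult
        bounded_linear_fst_comp bounded_linear_snd_comp bounded_linear_ident)
  then show ?thesis by (simp add: double_op_def Endo_inverse bounded_linear_Blinfun_apply)
qed

lemma rot_square: "rot * rot = (- 1 :: ('w::real_normed_vector) double endo)"
proof -
  have "endo_fun (rot * rot + 1) x = endo_fun 0 x" for x :: "'w double"
    by (cases x) (simp add: endo_fun_simps endo_fun_rot zero_endo.rep_eq zero_prod_def)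
  then have "rot * rot + 1 = (0 :: 'w double endo)" by (rule endo_eqI)
  then show ?thesis by (simp add: eq_neg_iff_add_eq_0)
qed

lemma complex_scalars_cscalar:
  "complex_scalars (cscalar :: complex \<Rightarrow> ('w::banach) double endo)"
proof (rule complex_scalars.intro)
  show "bounded_linear (cscalar :: complex \<Rightarrow> 'w double endo)"
    unfolding cscalar_def
    by (intro bounded_linear_add bounded_linear_scaleR_const bounded_linear_Re bounded_linear_Im)
  show "cscalar (x * y) = (cscalar x * cscalar y :: 'w double endo)" for x y
  proof -
    have "(cscalar x * cscalar y :: 'w double endo) =
        (Re x * Re y) *\<^sub>R 1 + (Im x * Im y) *\<^sub>R (rot * rot) + (Re x * Im y + Im x * Re y) *\<^sub>R rot"
      by (simp add: cscalar_def distrib_left distrib_right scaleR_add_right scaleR_left_distrib mult.commute add_ac)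
    then show ?thesis
      by (simp add: cscalar_def rot_square scaleR_left_diff_distrib)
  qed
  show "cscalar 1 = (1 :: 'w double endo)"
    by (simp add: cscalar_def)
qed

interpretation cscalar: complex_scalars "cscalar :: complex \<Rightarrow> ('w::banach) double endo"
  by (rule complex_scalars_cscalar)

lemma cscalar_double_op_commute: "cscalar z * double_op r X = double_op r X * cscalar z"
proof -
  have "rot * double_op r X = double_op r X * rot"
  proof (rule endo_eqI)
    fix x :: "'a double"
    show "endo_fun (rot * double_op r X) x = endo_fun (double_op r X * rot) x"
      by (cases x; cases "fst x"; cases "snd x")
        (auto simp: endo_fun_simps endo_fun_rot endo_fun_double_op blinfun.minus_right)
  qed
  then show ?thesis by (simp add: cscalar_def distrib_left distrib_right)
qed

lemma double_op_mult: "double_op r X * double_op q Y = double_op (r * q) (X o\<^sub>L Y)"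
proof (rule endo_eqI)
  fix x :: "'a double"
  show "endo_fun (double_op r X * double_op q Y) x = endo_fun (double_op (r * q) (X o\<^sub>L Y)) x"
    by (cases x; cases "fst x"; cases "snd x") (auto simp: endo_fun_simps endo_fun_double_op)
qed

lemma double_op_add: "double_op r X + double_op q Y = double_op (r + q) (X + Y)"
proof (rule endo_eqI)
  fix x :: "'a double"
  show "endo_fun (double_op r X + double_op q Y) x = endo_fun (double_op (r + q) (X + Y)) x"
    by (cases x; cases "fst x"; cases "snd x")
      (auto simp: endo_fun_simps endo_fun_double_op blinfun.add_left distrib_right)
qed

lemma double_op_1: "double_op 1 id_blinfun = 1"
proof (rule endo_eqI)
  fix x :: "'a double"
  show "endo_fun (double_op 1 id_blinfun) x = endo_fun 1 x"
    by (cases x; cases "fst x"; cases "snd x") (auto simp: endo_fun_simps endo_fun_double_op)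
qed

text \<open>On the real factors the pencil acts by the squared modulus of \<open>r - z\<close>,
  which vanishes only at \<open>z = r\<close>.\<close>

lemma pencil_double_op:
  assumes "fst s = Re z" "norm s = cmod z"
  shows "pencil z (double_op r X) =
    double_op ((r - Re z)\<^sup>2 + (Im z)\<^sup>2) (S_pencil s X)"
proof (rule endo_eqI)
  fix x
  have r: "(r - Re z)\<^sup>2 + (Im z)\<^sup>2 = r * r - 2 * Re z * r + (cmod z)\<^sup>2"
    unfolding cmod_power2 by (simp add: power2_eq_square algebra_simps)
  show "endo_fun (pencil z (double_op r X)) x =
      endo_fun (double_op ((r - Re z)\<^sup>2 + (Im z)\<^sup>2) (S_pencil s X)) x"
    unfolding r
    by (cases x; cases "fst x"; cases "snd x")
      (auto simp: pencil_def endo_fun_simps endo_fun_double_op S_pencil_apply assms algebra_simps)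
qed

lemma pencil_double_op_inverse:
  assumes "fst s = Re z" "norm s = cmod z" "is_op_inverse (S_pencil s X) Y"
    and "(r - Re z)\<^sup>2 + (Im z)\<^sup>2 \<noteq> 0"
  shows "is_inverse (pencil z (double_op r X)) (double_op (inverse ((r - Re z)\<^sup>2 + (Im z)\<^sup>2)) Y)"
  using assms(3,4)
  by (simp add: pencil_double_op[OF assms(1,2)] is_inverse_def is_op_inverse_def double_op_mult
      double_op_1)

text \<open>Compatibility on the copy of \<open>'w\<close> formed by real vectors with zero padding.
  A single factor \<open>cscalar z - double_op r X\<close> does not in general preserve this copy;
  symmetric expressions in it and its conjugate do.\<close>

definition extends_op :: "('w::real_normed_vector) double endo \<Rightarrow> ('w \<Rightarrow>\<^sub>L 'w) \<Rightarrow> bool" where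
  "extends_op Y X \<longleftrightarrow> (\<forall>u. endo_fun Y ((u, 0), 0) = ((X u, 0), 0))"

lemma extends_op_double_op: "extends_op (double_op r X) X"
  by (simp add: extends_op_def zero_prod_def endo_fun_double_op)

lemma extends_op_1: "extends_op 1 id_blinfun"
  by (simp add: extends_op_def endo_fun_simps)

lemma extends_op_mult: "extends_op Y X \<Longrightarrow> extends_op Y' X' \<Longrightarrow> extends_op (Y * Y') (X o\<^sub>L X')"
  by (simp add: extends_op_def endo_fun_simps)

lemma extends_op_power: "extends_op Y X \<Longrightarrow> extends_op (Y ^ n) (op_power X n)"
  by (induction n) (simp_all add: op_power_0 op_power_Suc extends_op_1 extends_op_mult)

text \<open>Defined for every endomorphism, linear and continuous, so it can be applied termwise to
  a series whose sum is not known to preserve the copy of \<open>'w\<close>.\<close>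

definition compression :: "('w::real_normed_vector) double endo \<Rightarrow> 'w \<Rightarrow>\<^sub>L 'w" where
  "compression Y = Blinfun (\<lambda>z. fst (fst z)) o\<^sub>L (endo_fun Y o\<^sub>L Blinfun (\<lambda>u. ((u, 0), 0)))"

lemma compression_apply: "compression Y u = fst (fst (endo_fun Y ((u, 0), 0)))"
proof -
  have "bounded_linear (\<lambda>z :: 'a double. fst (fst z))"
    by (intro bounded_linear_fst_comp bounded_linear_ident)
  moreover have "bounded_linear (\<lambda>u :: 'a. ((u, 0 :: real), 0 :: 'a \<times> real))"
    by (intro bounded_linear_Pair bounded_linear_ident bounded_linear_zero)
  ultimately show ?thesis
    by (simp add: compression_def bounded_linear_Blinfun_apply)
qed

lemma bounded_linear_compression: "bounded_linear compression"
proof -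
  have "bounded_linear (endo_fun :: 'a double endo \<Rightarrow> _)"
    by (rule bounded_linear_intro[of _ 1])
      (simp_all add: plus_endo.rep_eq scaleR_endo.rep_eq norm_endo.rep_eq)
  then show ?thesis
    unfolding compression_def
    by (rule bounded_linear_compose[OF
          bounded_bilinear.bounded_linear_right[OF bounded_bilinear_blinfun_compose]
          bounded_linear_compose[OF
            bounded_bilinear.bounded_linear_left[OF bounded_bilinear_blinfun_compose]]])
qed

lemma compression_extends_op: "extends_op Y X \<Longrightarrow> compression Y = X"
  by (rule blinfun_eqI) (simp add: extends_op_def compression_apply)

text \<open>\<open>Y\<close> need not have block form: \<open>double_op r X\<close> has, so the
  first component of each inverse relation at \<open>((u, 0), 0)\<close> involves only
  \<open>X\<close> and the first component of \<open>Y\<close>.\<close>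

lemma is_op_inverse_compression:
  assumes "is_inverse (double_op r X) Y"
  shows "is_op_inverse X (compression Y)"
proof -
  have 1: "endo_fun Y (endo_fun (double_op r X) x) = x"
    and 2: "endo_fun (double_op r X) (endo_fun Y x) = x" for x
    using assms by (simp_all add: is_inverse_def flip: endo_fun_simps(2))
      (simp_all add: endo_fun_simps(1))
  have "compression Y (X u) = u" for u
    using 1[of "((u, 0), 0)"] by (simp add: compression_apply endo_fun_double_op zero_prod_def)
  moreover have "X (compression Y u) = u" for u
  proof -
    obtain a p b q where z: "endo_fun Y ((u, 0), 0) = ((a, p), (b, q))"
      by (metis prod.collapse)
    then show ?thesis
      using 2[of "((u, 0), 0)"] by (simp add: compression_apply endo_fun_double_op)
  qed
  ultimately show ?thesis
    unfolding is_op_inverse_def by (auto intro!: blinfun_eqI)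
qed

text \<open>
  Invertibility of \<open>S_pencil x T\<close> depends on \<open>x\<close> only through \<open>fst x\<close> and \<open>norm x\<close>, so the points of
  the complex half-plane through \<open>s\<close> and their mirror images see the whole \<open>S\<close>-spectrum.
\<close>

lemma point_with_complex_coordinates:
  fixes s :: "real \<times> (real ^ 'n)"
  obtains f :: "complex \<Rightarrow> real \<times> (real ^ 'n)"
  where "\<And>x. fst (f x) = Re x" "\<And>x. norm (f x) = cmod x"
    "\<And>x. dist s (f x) = cmod (x - Complex (fst s) (norm (snd s)))"
proof -
  obtain w :: "real ^ 'n" where w: "norm w = 1" "snd s = norm (snd s) *\<^sub>R w"
  proof (cases "snd s = 0")
    case True
    \<comment> \<open>A real \<open>s\<close> singles out no direction, and any unit vector
      serves.\<close>
    then show thesis using that[of "axis undefined 1"] by simp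
  next
    case False
    then show thesis using that[of "snd s /\<^sub>R norm (snd s)"] by simp
  qed
  show thesis
  proof (rule that[of "\<lambda>x. (Re x, Im x *\<^sub>R w)"])
    fix x
    show "norm (Re x, Im x *\<^sub>R w) = cmod x"
      using w by (simp add: norm_prod_def cmod_def)
    have "dist (snd s) (Im x *\<^sub>R w) = \<bar>norm (snd s) - Im x\<bar>"
      by (subst w(2)) (simp add: dist_norm w(1) flip: scaleR_diff_left)
    then show "dist s (Re x, Im x *\<^sub>R w) = cmod (x - Complex (fst s) (norm (snd s)))"
      by (simp add: dist_prod_def cmod_def dist_real_def power2_commute)
  qed simp
qed

theorem theorem6p3:
  fixes T N :: "('v::banach ^ 'n::{finite,linorder} set) \<Rightarrow>\<^sub>L ('v ^ 'n set)"
    and s :: "real \<times> (real ^ 'n::{finite,linorder})"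
    and \<epsilon> :: real
  assumes "T \<in> paravector_operators" and "N \<in> paravector_operators"
    and "T o\<^sub>L N = N o\<^sub>L T"
    and "\<epsilon> > 0"
    and "S_spectrum N \<subseteq> ball 0 \<epsilon>"
    and "edist_set s (S_spectrum T) > ereal \<epsilon>"
  shows "s \<in> S_resolvent_set (T + N) \<and>
    (\<lambda>m. (\<Sum>k\<le>m. SL_star s T (k + 1) (m - k + 1)) o\<^sub>L op_power N m)
      sums op_inverse (S_pencil s (T + N))"
proof -
  \<comment> \<open>A finite radius, even when the spectrum is empty and the distance
    infinite.\<close>
  obtain R where R: "\<epsilon> < R" "ereal R < edist_set s (S_spectrum T)"
    using ereal_dense2[OF assms(6)] by auto
  define z where "z = Complex (fst s) (norm (snd s))"
  obtain f where
    f: "\<And>x. fst (f x) = Re x" "\<And>x. norm (f x) = cmod x" "\<And>x. dist s (f x) = cmod (x - z)"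
    using point_with_complex_coordinates[of s] unfolding z_def by metis
  have sz: "fst s = Re z" "norm s = cmod z"
    by (simp_all add: z_def norm_prod_def cmod_def)
  have invT: "op_invertible (S_pencil x T)" if "dist s x \<le> R" for x
  proof (rule ccontr)
    assume "\<not> op_invertible (S_pencil x T)"
    then have "edist_set s (S_spectrum T) \<le> ereal (dist s x)"
      unfolding edist_set_def by (intro INF_lower) (simp add: S_spectrum_def)
    also have "\<dots> \<le> ereal R" using that by simp
    finally show False using R(2) by simp
  qed
  have invN: "op_invertible (S_pencil x N)" if "norm x \<ge> \<epsilon>" for x
  proof (rule ccontr)
    assume "\<not> op_invertible (S_pencil x N)"
    then have "x \<in> ball 0 \<epsilon>" using assms(5) by (auto simp: S_spectrum_def)
    then show False using that by simp
  qed
  \<comment> \<open>The padding scalar for \<open>T\<close> lies to the right of the disc of radius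
    \<open>R\<close> about \<open>z\<close>. For \<open>N\<close> the scalar 0 will do, as it lies
    inside the \<epsilon>-disc.\<close>
  define t where "t = fst s + R + 1"
  define T' N' where "T' = double_op t T" and "N' = double_op 0 N"
  have t: "(t - Re x)\<^sup>2 + (Im x)\<^sup>2 \<noteq> 0" if "cmod (x - z) \<le> R" for x
  proof -
    have "Re x - fst s \<le> R"
      using that complex_Re_le_cmod[of "x - z"] by (simp add: sz)
    then have "t - Re x \<noteq> 0" by (simp add: t_def)
    then show ?thesis by (simp add: sum_power2_eq_zero_iff)
  qed
  define Q where "Q = op_inverse (S_pencil s T)"
  define \<rho> where "\<rho> = (t - Re z)\<^sup>2 + (Im z)\<^sup>2"
  have s_inv: "op_invertible (S_pencil s T)"
    using invT[of s] R assms(4) by simp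
  then have Q: "is_op_inverse (S_pencil s T) Q"
    unfolding Q_def by (rule op_inverse)
  have \<rho>: "\<rho> \<noteq> 0"
    unfolding \<rho>_def using R assms(4) by (intro t) simp
  have comm: "cscalar x * T' = T' * cscalar x" "cscalar x * N' = N' * cscalar x" for x
    by (simp_all add: T'_def N'_def cscalar_double_op_commute)
  have PT: "\<exists>Y. is_inverse (pencil x T') Y" if "cmod (x - z) \<le> R" for x
    using invT[of "f x"] that pencil_double_op_inverse[OF f(1,2) _ t[OF that]]
    unfolding T'_def op_invertible_def f(3) by blast
  have PN: "\<exists>Y. is_inverse (pencil x N') Y" if "cmod x \<ge> \<epsilon>" for x
  proof -
    have "x \<noteq> 0" using that assms(4) by auto
    then have "(0 - Re x)\<^sup>2 + (Im x)\<^sup>2 \<noteq> 0"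
      by (simp add: sum_power2_eq_zero_iff complex_eq_iff)
    then show ?thesis
      using invN[of "f x"] that pencil_double_op_inverse[OF f(1,2)]
      unfolding N'_def op_invertible_def f(2) by blast
  qed
  have PQ: "is_inverse (pencil z T') (double_op (inverse \<rho>) Q)"
    using pencil_double_op_inverse[OF sz Q] \<rho> unfolding T'_def \<rho>_def by blast
  have TN: "T' * N' = N' * T'"
    by (simp add: T'_def N'_def double_op_mult assms(3))
  obtain S where S: "is_inverse (pencil z (T' + N')) S"
    "(\<lambda>m. double_op (inverse \<rho>) Q ^ Suc m * homog (cscalar (cnj z) - T') (cscalar z - T') m * N' ^ m)
      sums S"
    by (rule cscalar.pencil_perturbation_series[OF comm TN assms(4) R(1) PT PN PQ])
  let ?h = "homog (cscalar (cnj z) - T') (cscalar z - T')"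
  have ab: "(cscalar (cnj z) - T') * (cscalar z - T') = double_op \<rho> (S_pencil s T)"
    unfolding \<rho>_def T'_def pencil_double_op[OF sz, symmetric]
    by (rule cscalar.pencil_factor'[OF cscalar_double_op_commute])
  have ab_comm: "(cscalar (cnj z) - T') * (cscalar z - T') = (cscalar z - T') * (cscalar (cnj z) - T')"
    unfolding T'_def by (simp only: cscalar.pencil_factor'[OF cscalar_double_op_commute]
      cscalar.pencil_factor[OF cscalar_double_op_commute])
  have add: "cscalar (cnj z) - T' + (cscalar z - T') = (2 * fst s) *\<^sub>R 1 - 2 *\<^sub>R T'"
    by (simp add: cscalar_def sz scaleR_2 flip: scaleR_left.add)
  have T'_ext: "endo_fun T' ((u, 0), 0) = ((T u, 0), 0)" for u
    using extends_op_double_op unfolding extends_op_def T'_def by blast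
  \<comment> \<open>Two consecutive degrees are carried along because the recursion has order
    two.\<close>
  have "extends_op (?h m) (cpoly_eval T (homog_cpoly s m)) \<and>
      extends_op (?h (Suc m)) (cpoly_eval T (homog_cpoly s (Suc m)))" for m
  proof (induction m)
    case 0
    show ?case
      unfolding extends_op_def cpoly_eval_homog_0 cpoly_eval_homog_1
      by (simp add: homog_0 homog_1 add endo_fun_simps T'_ext)
  next
    case (Suc m)
    have P: "extends_op (double_op \<rho> (S_pencil s T)) (S_pencil s T)"
      by (rule extends_op_double_op)
    have "extends_op (?h (Suc (Suc m))) (cpoly_eval T (homog_cpoly s (Suc (Suc m))))"
      using Suc P unfolding extends_op_def cpoly_eval_homog_rec homog_rec[OF ab_comm] ab add
      by (simp add: endo_fun_simps T'_ext left_diff_distrib)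
    with Suc show ?case by blast
  qed
  then have h: "extends_op (?h m) (cpoly_eval T (homog_cpoly s m))" for m by blast
  have "compression (double_op (inverse \<rho>) Q ^ Suc m * ?h m * N' ^ m) =
      (\<Sum>k\<le>m. SL_star s T (k + 1) (m - k + 1)) o\<^sub>L op_power N m" for m
  proof -
    have "(\<Sum>k\<le>m. SL_star s T (k + 1) (m - k + 1)) o\<^sub>L op_power N m =
        op_power Q (Suc m) o\<^sub>L cpoly_eval T (homog_cpoly s m) o\<^sub>L op_power N m"
      unfolding Q_def by (rule blinfun_eqI) (simp add: sum_SL_star_apply[OF s_inv, simplified])
    then show ?thesis
      unfolding N'_def
      by (simp only:) (intro compression_extends_op extends_op_mult extends_op_power h
          extends_op_double_op)
  qed
  then have series: "(\<lambda>m. (\<Sum>k\<le>m. SL_star s T (k + 1) (m - k + 1)) o\<^sub>L op_power N m)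
      sums compression S"
    using bounded_linear.sums[OF bounded_linear_compression S(2)] by (simp only:)
  \<comment> \<open>The padding scalars add up to \<open>t + 0\<close>, hence the same
    \<open>\<rho>\<close> as for \<open>T'\<close>.\<close>
  have "pencil z (T' + N') = double_op \<rho> (S_pencil s (T + N))"
    unfolding T'_def N'_def double_op_add \<rho>_def by (simp add: pencil_double_op[OF sz])
  then have inv: "is_op_inverse (S_pencil s (T + N)) (compression S)"
    using S(1) by (intro is_op_inverse_compression) simp
  then have "op_invertible (S_pencil s (T + N))"
    by (auto simp: op_invertible_def)
  moreover from this have "op_inverse (S_pencil s (T + N)) = compression S"
    by (rule Defs.is_op_inverse_unique[OF op_inverse inv])
  ultimately show ?thesis
    using series by (simp add: S_resolvent_set_def S_spectrum_def)
qed

end
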